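(* Assume that $\rho_0\in C^1(\mathbb{R})$, that $\lim_{x\to\pm\infty}\rho_0(x)=\rho_\pm\in(0,+\infty)$, and that there is a constant $\rho_m<+\infty$ such that $0<\rho_0'(x)<\rho_m$ for all $x\in\mathbb{R}$. Then for every sufficiently small $\epsilon_\star>0$ there exists an integer $N(\epsilon_\star)\ge 1$ such that there are at least $N(\epsilon_\star)$ values of $\lambda\in\left[\epsilon_\star,\sqrt{g/L_0}\right]$ for which there exists $\phi\in H^4(\mathbb{R})$, $\phi\not\equiv0$, satisfying on $\mathbb{R}$ $$-\lambda^2\left(\rho_0k^2\phi-(\rho_0\phi')'\right)=\lambda\mu\left(\phi^{(4)}-2k^2\phi''+k^4\phi\right)-gk^2\rho_0'\phi .$$
   Context: The constants $g>0$, $\mu>0$, $k>0$ are fixed. Primes denote $d/dx$, and $L_0>0$ is defined by $L_0^{-1}=\sup_{\mathbb{R}}\rho_0'/\rho_0$. All functions are real-valued. *)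

theory Defs
  imports "HOL-Analysis.Analysis"
begin

definition test_function :: "(real \<Rightarrow> real) \<Rightarrow> bool" where
  "test_function \<psi> \<longleftrightarrow>
     (\<forall>n x. ((deriv ^^ n) \<psi>) field_differentiable at x) \<and>
     compact (closure {x. \<psi> x \<noteq> 0})"

definition locally_integrable :: "(real \<Rightarrow> real) \<Rightarrow> bool" where
  "locally_integrable f \<longleftrightarrow> (\<forall>K. compact K \<longrightarrow> set_integrable lborel K f)"

text \<open>The \<open>n\<close>-th distributional derivative is a relation between functions, since it is only
  determined up to null sets.\<close>

definition weak_deriv :: "nat \<Rightarrow> (real \<Rightarrow> real) \<Rightarrow> (real \<Rightarrow> real) \<Rightarrow> bool" where
  "weak_deriv n f h \<longleftrightarrow>
     locally_integrable f \<and> locally_integrable h \<and>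
     (\<forall>\<psi>. test_function \<psi> \<longrightarrow>
        (LINT x|lborel. f x * (deriv ^^ n) \<psi> x) = (-1) ^ n * (LINT x|lborel. h x * \<psi> x))"

definition square_integrable :: "(real \<Rightarrow> real) \<Rightarrow> bool" where
  "square_integrable f \<longleftrightarrow> f \<in> borel_measurable lborel \<and> integrable lborel (\<lambda>x. (f x)\<^sup>2)"

text \<open>\<open>sobolev_H m\<close> is the set of all (Borel) representatives of elements of \<open>H\<^sup>m(\<real>) = W\<^sup>m\<^sup>,\<^sup>2(\<real>)\<close>.\<close>

definition sobolev_H :: "nat \<Rightarrow> (real \<Rightarrow> real) set" where
  "sobolev_H m = {f. square_integrable f \<and>
     (\<forall>j\<le>m. \<exists>h. square_integrable h \<and> weak_deriv j f h)}"

text \<open>The supremum is a conditionally complete one, so this is meaningful only if \<open>\<rho>'/\<rho>\<close> is bounded above.\<close>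

definition L0 :: "(real \<Rightarrow> real) \<Rightarrow> real" where
  "L0 \<rho> = inverse (SUP x. deriv \<rho> x / \<rho> x)"

text \<open>The derivatives of \<open>\<phi>\<close> are weak ones and the equation is an identity of (classes of) functions,
  i.e. it holds almost everywhere. The functions \<open>\<phi>1\<close>, \<open>\<phi>2\<close>, \<open>\<phi>4\<close> represent \<open>\<phi>'\<close>, \<open>\<phi>''\<close>,
  \<open>\<phi>\<^sup>(\<^sup>4\<^sup>)\<close>, and \<open>d\<close> represents \<open>(\<rho> \<phi>')'\<close>.\<close>

definition solves_eq ::
  "real \<Rightarrow> real \<Rightarrow> real \<Rightarrow> (real \<Rightarrow> real) \<Rightarrow> real \<Rightarrow> (real \<Rightarrow> real) \<Rightarrow> bool" where
  "solves_eq g \<mu> k \<rho> lam \<phi> \<longleftrightarrow>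
     (\<exists>\<phi>1 \<phi>2 \<phi>4 d.
        weak_deriv 1 \<phi> \<phi>1 \<and> weak_deriv 2 \<phi> \<phi>2 \<and> weak_deriv 4 \<phi> \<phi>4 \<and>
        weak_deriv 1 (\<lambda>x. \<rho> x * \<phi>1 x) d \<and>
        (AE x in lborel.
           - (lam\<^sup>2) * (\<rho> x * k\<^sup>2 * \<phi> x - d x) =
           lam * \<mu> * (\<phi>4 x - 2 * k\<^sup>2 * \<phi>2 x + k ^ 4 * \<phi> x) - g * k\<^sup>2 * deriv \<rho> x * \<phi> x))"

end

theory Submission
  imports Defs "HOL-Complex_Analysis.Great_Picard"
begin

text \<open>It suffices to produce one eigenvalue \<open>L > 0\<close>, since \<open>\<epsilon>\<^sub>0 = L\<close> and \<open>N = 1\<close> are then admissible.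
  Testing the equation with \<open>\<phi>\<close> itself gives \<open>L\<^sup>2 A(\<phi>) + L B(\<phi>) = G(\<phi>)\<close>, where \<open>A\<close> is the kinetic,
  \<open>B\<close> the viscous and \<open>G = g k\<^sup>2 \<integral> \<rho>' \<phi>\<^sup>2\<close> the buoyancy form. Let \<open>L\<close> be the supremum of all \<open>l > 0\<close> with
  \<open>l\<^sup>2 A + l B \<le> G\<close> at some nonzero test function; it is at most \<open>\<surd>(g / L\<^sub>0)\<close> because
  \<open>\<rho>' \<le> \<rho> / L\<^sub>0\<close>. Then \<open>L\<^sup>2 A + L B - G\<close> is nonnegative, and a maximizing sequence normalized by
  \<open>G = 1\<close> is bounded in \<open>H\<^sup>2\<close>. Its values and first derivatives converge pointwise along a subsequence,
  and \<open>G\<close> is continuous under this convergence because \<open>\<rho>'\<close> is integrable, so the limit does not vanish.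
  By Cauchy--Schwarz for the nonnegative form the limit is a weak solution, and the du Bois-Reymond
  lemma makes it a classical one.\<close>

section \<open>Compactly supported functions\<close>

text \<open>The parameter enters both linearly and quadratically, so the critical \<open>L\<close>
  is not the extremum of a quotient of two forms. What takes its place is the scaling
  \<open>t\<^sup>2 * energy L u u \<le> energy (t * L) u u \<le> t * energy L u u\<close> for 0 < t
  <= 1: it makes the set of admissible parameters nonempty, turns failure just above
  \<open>L\<close> into nonnegativity of the form at \<open>L\<close>, and turns success just below
  \<open>L\<close> into a maximizing sequence. That sequence is bounded in H^2, but only values and
  first derivatives converge pointwise. The first variation is therefore rewritten with at most one
  derivative on the solution and up to three on the test function, which is why jets of length 3 are
  used. On the whole line a classical solution need not lie in H^4. Square integrability is obtained
  in the order f, f', f'', f'''', f''': bounds along the sequence give the first three, the equation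
  with its bounded coefficients gives f'''', and interpolation gives f'''.\<close>

definition csc :: "(real \<Rightarrow> real) \<Rightarrow> bool" where
  "csc f \<longleftrightarrow> continuous_on UNIV f \<and> (\<exists>R. \<forall>x. R < \<bar>x\<bar> \<longrightarrow> f x = 0)"

lemma csc_continuous: "csc f \<Longrightarrow> continuous_on UNIV f"
  by (simp add: csc_def)

lemma csc_add:
  assumes "csc f" "csc h" shows "csc (\<lambda>x. f x + h x)"
proof -
  obtain R S where "\<forall>x. R < \<bar>x\<bar> \<longrightarrow> f x = 0" "\<forall>x. S < \<bar>x\<bar> \<longrightarrow> h x = 0"
    using assms by (auto simp: csc_def)
  then have "\<forall>x. max R S < \<bar>x\<bar> \<longrightarrow> f x + h x = 0" by auto
  then show ?thesis using assms unfolding csc_def by (blast intro: continuous_on_add)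
qed

lemma csc_mult:
  assumes "continuous_on UNIV f" "csc h" shows "csc (\<lambda>x. f x * h x)"
  using assms unfolding csc_def by (force intro: continuous_on_mult)

lemma csc_mult': "csc h \<Longrightarrow> continuous_on UNIV f \<Longrightarrow> csc (\<lambda>x. h x * f x)"
  using csc_mult[of f h] by (simp add: mult.commute)

lemma csc_cmult: "csc f \<Longrightarrow> csc (\<lambda>x. c * f x)"
  by (rule csc_mult) auto

lemma csc_minus: "csc f \<Longrightarrow> csc (\<lambda>x. - f x)"
  using csc_cmult[of f "-1"] by simp

lemma csc_diff: "csc f \<Longrightarrow> csc h \<Longrightarrow> csc (\<lambda>x. f x - h x)"
  using csc_add[OF _ csc_minus, of f h] by simp

lemma csc_square: "csc f \<Longrightarrow> csc (\<lambda>x. (f x)\<^sup>2)"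
  unfolding power2_eq_square by (intro csc_mult csc_continuous)

lemmas csc_intros = csc_add csc_diff csc_minus csc_cmult csc_mult csc_mult' csc_square
  csc_continuous

lemma csc_integrable:
  assumes "csc f" shows "integrable lborel f"
proof -
  obtain R where R: "\<forall>x. R < \<bar>x\<bar> \<longrightarrow> f x = 0" using assms by (auto simp: csc_def)
  have "set_integrable lborel {-R..R} f"
    using assms by (intro borel_integrable_atLeastAtMost') (auto simp: csc_def intro: continuous_on_subset)
  moreover have "(\<lambda>x. indicator {-R..R} x *\<^sub>R f x) = f"
  proof
    fix x show "indicator {-R..R} x *\<^sub>R f x = f x"
      using R[rule_format, of x] by (cases "R < \<bar>x\<bar>") (auto simp: indicator_def)
  qed
  ultimately show ?thesis by (simp add: set_integrable_def)
qed

lemma continuous_measurable: "continuous_on UNIV (f :: real \<Rightarrow> real) \<Longrightarrow> f \<in> borel_measurable lborel"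
  by (simp add: borel_measurable_continuous_onI)

lemma continuous_on_DERIV:
  "(\<And>x. (f has_real_derivative f' x) (at x)) \<Longrightarrow> continuous_on UNIV f"
  by (meson DERIV_isCont continuous_at_imp_continuous_on)

lemma integral_indicator_DERIV:
  assumes "a \<le> b" "\<And>x. (f has_real_derivative f' x) (at x)" "continuous_on UNIV f'"
  shows "integrable lborel (\<lambda>x. f' x * indicator {a..b} x)"
    and "(LINT x|lborel. f' x * indicator {a..b} x) = f b - f a"
proof -
  have "isCont f' x" for x using assms(3) continuous_on_eq_continuous_at by blast
  then have "has_bochner_integral lborel (\<lambda>x. f' x * indicator {a..b} x) (f b - f a)"
    using assms by (intro has_bochner_integral_FTC_Icc_real) auto
  then show "integrable lborel (\<lambda>x. f' x * indicator {a..b} x)"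
    and "(LINT x|lborel. f' x * indicator {a..b} x) = f b - f a"
    by (auto simp: has_bochner_integral_iff)
qed

lemma integral_csc_DERIV_zero:
  assumes f: "csc f" and f': "csc f'" and d: "\<And>x. (f has_real_derivative f' x) (at x)"
  shows "(LINT x|lborel. f' x) = 0"
proof -
  obtain R S where R: "\<forall>x. R < \<bar>x\<bar> \<longrightarrow> f x = 0" and S: "\<forall>x. S < \<bar>x\<bar> \<longrightarrow> f' x = 0"
    using f f' by (auto simp: csc_def)
  define T where "T = max 0 (max R S) + 1"
  have T: "T > R" "T > S" "T > 0" by (auto simp: T_def)
  have "(\<lambda>x. f' x * indicator {-T..T} x) = f'"
  proof
    fix x show "f' x * indicator {-T..T} x = f' x"
      using S[rule_format, of x] T by (cases "S < \<bar>x\<bar>") (auto simp: indicator_def)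
  qed
  then have "(LINT x|lborel. f' x) = f T - f (-T)"
    using integral_indicator_DERIV(2)[OF _ d csc_continuous[OF f'], of "-T" T] T by simp
  then show ?thesis using R[rule_format, of T] R[rule_format, of "-T"] T by auto
qed

lemma integral_by_parts_csc:
  assumes f: "\<And>x. (f has_real_derivative f' x) (at x)" "continuous_on UNIV f'"
    and v: "\<And>x. (v has_real_derivative v' x) (at x)" "csc v" "csc v'"
  shows "(LINT x|lborel. f x * v' x) = - (LINT x|lborel. f' x * v x)"
proof -
  have c: "csc (\<lambda>x. f x * v x)" "csc (\<lambda>x. f x * v' x)" "csc (\<lambda>x. f' x * v x)"
    using v f continuous_on_DERIV[OF f(1)] by (auto intro: csc_mult)
  have "(LINT x|lborel. f' x * v x + f x * v' x) = 0"
    by (rule integral_csc_DERIV_zero[OF c(1) csc_add[OF c(3,2)]])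
      (auto intro!: derivative_eq_intros f v simp: algebra_simps)
  moreover have "(LINT x|lborel. f' x * v x + f x * v' x)
      = (LINT x|lborel. f' x * v x) + (LINT x|lborel. f x * v' x)"
    using c by (intro Bochner_Integration.integral_add csc_integrable)
  ultimately show ?thesis by simp
qed

lemma antiderivative_exists:
  fixes f :: "real \<Rightarrow> real" assumes "continuous_on UNIV f"
  obtains F where "\<And>x. (F has_real_derivative f x) (at x)"
proof -
  have "\<exists>F. \<forall>x. (-\<infinity>::ereal) < ereal x \<longrightarrow> ereal x < \<infinity> \<longrightarrow> (F has_vector_derivative f x) (at x)"
    using assms by (intro einterval_antiderivative) (auto simp: continuous_on_eq_continuous_at)
  then show ?thesis using that by (auto simp: has_real_derivative_iff_has_vector_derivative)
qed

text \<open>A primitive is constant on each side of the support, and zero mean makes the two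
  constants equal; subtracting the common value gives compact support. This is how the mean of a
  test function enters the du Bois-Reymond argument.\<close>

lemma csc_antiderivative:
  assumes f: "csc f" and 0: "(LINT x|lborel. f x) = 0"
  obtains F where "csc F" "\<And>x. (F has_real_derivative f x) (at x)"
proof -
  obtain R where R: "\<forall>x. R < \<bar>x\<bar> \<longrightarrow> f x = 0" using f by (auto simp: csc_def)
  obtain G where G: "\<And>x. (G has_real_derivative f x) (at x)"
    using antiderivative_exists[OF csc_continuous[OF f]] by blast
  define T where "T = max 0 R + 1"
  have out: "\<And>x. T \<le> \<bar>x\<bar> \<Longrightarrow> f x = 0" using R by (auto simp: T_def)
  have T: "T > 0" by (simp add: T_def)
  have "(\<lambda>x. f x * indicator {-T..T} x) = f"
  proof
    fix x show "f x * indicator {-T..T} x = f x"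
      using out[of x] by (cases "T \<le> \<bar>x\<bar>") (auto simp: indicator_def)
  qed
  then have GT: "G T = G (-T)"
    using integral_indicator_DERIV(2)[OF _ G csc_continuous[OF f], of "-T" T] T 0 by simp
  have r: "G x = G T" if "T < x" for x
    by (rule DERIV_isconst_end[OF that, symmetric, symmetric])
      (use T in \<open>auto intro!: continuous_on_subset[OF continuous_on_DERIV[OF G]] DERIV_cong[OF G] out\<close>)
  have l: "G x = G T" if "x < -T" for x
  proof -
    have "G (-T) = G x"
      by (rule DERIV_isconst_end[OF that])
        (use T in \<open>auto intro!: continuous_on_subset[OF continuous_on_DERIV[OF G]] DERIV_cong[OF G] out\<close>)
    then show ?thesis using GT by simp
  qed
  have d: "((\<lambda>x. G x - G T) has_real_derivative f x) (at x)" for x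
    by (auto intro!: derivative_eq_intros G)
  have "csc (\<lambda>x. G x - G T)"
    unfolding csc_def using continuous_on_DERIV[OF d] r l
    by (auto intro!: exI[of _ T] simp: abs_real_def split: if_splits)
  then show ?thesis using that d by blast
qed

text \<open>The set where \<open>f\<close> does not vanish is open and a Lebesgue null set, hence
  empty.\<close>

lemma continuous_integral_zero:
  assumes f: "continuous_on UNIV f" "integrable lborel f" and nn: "\<And>x. 0 \<le> f x"
    and 0: "(LINT x|lborel. f x) = (0::real)"
  shows "f x = (0::real)"
proof (rule ccontr)
  assume nz: "f x \<noteq> 0"
  have "AE x in lborel. f x = 0"
    using integral_nonneg_eq_0_iff_AE[OF f(2)] nn 0 by auto
  then have "AE x in lebesgue. x \<notin> {x. f x \<noteq> 0}" by (auto intro: AE_completion)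
  moreover have "{x. f x \<noteq> 0} \<in> sets lebesgue"
    using f(1) by (intro borel_open[THEN sets_completionI_sets[of _ lborel, simplified]] open_Collect_neq) auto
  ultimately have "{x. f x \<noteq> 0} \<in> null_sets lebesgue"
    by (simp add: AE_iff_null_sets)
  then have "negligible {x. f x \<noteq> 0}" by (simp add: negligible_iff_null_sets)
  moreover have "open {x. f x \<noteq> 0}"
    using f(1) by (intro open_Collect_neq) auto
  ultimately show False using nz open_not_negligible by blast
qed

text \<open>Fatou's lemma bounds the integral of the limit by \<open>M\<close>. No dominating
  function is available where this is used, so only integrability of the limit is claimed, not
  convergence of the integrals.\<close>

lemma fatou_integrable:
  fixes s :: "nat \<Rightarrow> real \<Rightarrow> real"
  assumes s: "\<And>n. integrable lborel (s n)" "\<And>n x. 0 \<le> s n x" "\<And>n. (LINT x|lborel. s n x) \<le> M"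
    and lim: "\<And>x. (\<lambda>n. s n x) \<longlonglongrightarrow> f x" and f: "f \<in> borel_measurable lborel"
  shows "integrable lborel f"
proof (rule integrableI_bounded[OF f])
  have f0: "0 \<le> f x" for x using lim[of x] s(2) by (intro LIMSEQ_le_const) auto
  have "(\<integral>\<^sup>+x. ennreal (norm (f x)) \<partial>lborel) = (\<integral>\<^sup>+x. liminf (\<lambda>n. ennreal (s n x)) \<partial>lborel)"
  proof (rule nn_integral_cong)
    fix x
    have "(\<lambda>n. ennreal (s n x)) \<longlonglongrightarrow> ennreal (f x)" using lim[of x] by (intro tendsto_ennrealI)
    then show "ennreal (norm (f x)) = liminf (\<lambda>n. ennreal (s n x))"
      using f0[of x] by (simp add: lim_imp_Liminf)
  qed
  also have "\<dots> \<le> liminf (\<lambda>n. \<integral>\<^sup>+x. ennreal (s n x) \<partial>lborel)"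
    using s by (intro nn_integral_liminf) auto
  also have "\<dots> \<le> liminf (\<lambda>n. ennreal M)"
    using s by (intro Liminf_mono always_eventually allI)
      (subst nn_integral_eq_integral, auto intro: ennreal_leI)
  also have "\<dots> < \<infinity>" by (simp add: Liminf_const)
  finally show "(\<integral>\<^sup>+x. ennreal (norm (f x)) \<partial>lborel) < \<infinity>" .
qed

section \<open>One-dimensional Sobolev and Hoelder bounds, and compactness\<close>

lemma csc_sup_bound:
  assumes "csc f" "csc f'" and d: "\<And>x. (f has_real_derivative f' x) (at x)"
  shows "(f x)\<^sup>2 \<le> (LINT x|lborel. (f x)\<^sup>2) + (LINT x|lborel. (f' x)\<^sup>2)"
proof -
  obtain R where R: "\<forall>x. R < \<bar>x\<bar> \<longrightarrow> f x = 0" using assms by (auto simp: csc_def)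
  \<comment> \<open>A point to the left of \<open>x\<close> and outside the support, so that
    \<open>(f x)\<^sup>2\<close> is the integral of \<open>2 * f * f'\<close> over
    \<open>{a..x}\<close>; that integrand is at most \<open>f\<^sup>2 + f'\<^sup>2\<close>.\<close>
  define a where "a = - (max \<bar>R\<bar> \<bar>x\<bar>) - 1"
  have a: "f a = 0" "a \<le> x" using R[rule_format, of a] by (auto simp: a_def)
  have cont: "continuous_on UNIV f" "continuous_on UNIV f'" using assms csc_continuous by auto
  have D: "((\<lambda>x. (f x)\<^sup>2) has_real_derivative 2 * f x * f' x) (at x)" for x
    by (auto intro!: derivative_eq_intros d)
  have C: "continuous_on UNIV (\<lambda>x. 2 * f x * f' x)" using cont by (intro continuous_intros)
  have "(f x)\<^sup>2 = (LINT y|lborel. 2 * f y * f' y * indicator {a..x} y)"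
    using integral_indicator_DERIV(2)[OF a(2) D C] a by simp
  also have "\<dots> \<le> (LINT x|lborel. (f x)\<^sup>2 + (f' x)\<^sup>2)"
  proof (rule integral_mono)
    show "integrable lborel (\<lambda>y. 2 * f y * f' y * indicator {a..x} y)"
      by (rule integral_indicator_DERIV(1)[OF a(2) D C])
    show "integrable lborel (\<lambda>y. (f y)\<^sup>2 + (f' y)\<^sup>2)"
      using assms by (intro csc_integrable csc_intros)
    fix y show "2 * f y * f' y * indicator {a..x} y \<le> (f y)\<^sup>2 + (f' y)\<^sup>2"
      using sum_squares_bound[of "f y" "f' y"] by (auto simp: indicator_def)
  qed
  also have "\<dots> = (LINT x|lborel. (f x)\<^sup>2) + (LINT x|lborel. (f' x)\<^sup>2)"
    using assms by (intro Bochner_Integration.integral_add csc_integrable csc_square)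
  finally show ?thesis .
qed

text \<open>The proof expands the nonnegative integral of \<open>(f' - m)\<^sup>2\<close> over \<open>[x, y]\<close>, with \<open>m\<close> the mean slope.\<close>

lemma csc_holder_bound:
  assumes "csc f'" and d: "\<And>x. (f has_real_derivative f' x) (at x)"
  shows "(f x - f y)\<^sup>2 \<le> (LINT x|lborel. (f' x)\<^sup>2) * \<bar>x - y\<bar>"
proof (induction x y rule: linorder_wlog)
  case (le x y)
  show ?case
  proof (cases "x = y")
    case False
    then have h: "y - x > 0" using le by simp
    have cont: "continuous_on UNIV f'" using assms csc_continuous by auto
    define m where "m = (f y - f x) / (y - x)"
    obtain G where G: "\<And>x. (G has_real_derivative (f' x)\<^sup>2) (at x)"
      using antiderivative_exists[of "\<lambda>x. (f' x)\<^sup>2"] cont by (auto intro: continuous_intros)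
    have CG: "continuous_on UNIV (\<lambda>x. (f' x)\<^sup>2)" using cont by (intro continuous_intros)
    have D: "((\<lambda>t. G t - 2 * m * f t + m\<^sup>2 * t) has_real_derivative (f' t - m)\<^sup>2) (at t)" for t
      by (auto intro!: derivative_eq_intros G d simp: power2_eq_square algebra_simps)
    have "0 \<le> (LINT t|lborel. (f' t - m)\<^sup>2 * indicator {x..y} t)"
      by (intro Bochner_Integration.integral_nonneg) auto
    also have "\<dots> = (G y - 2 * m * f y + m\<^sup>2 * y) - (G x - 2 * m * f x + m\<^sup>2 * x)"
      using cont by (intro integral_indicator_DERIV(2) D le continuous_intros)
    also have "\<dots> = (G y - G x) - 2 * m * (f y - f x) + m * (m * (y - x))"
      by (simp add: algebra_simps power2_eq_square)
    also have "\<dots> = (G y - G x) - (f y - f x)\<^sup>2 / (y - x)"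
      using h by (simp add: m_def power2_eq_square)
    finally have "(f y - f x)\<^sup>2 \<le> (G y - G x) * (y - x)"
      using h by (simp add: field_simps)
    also have "G y - G x = (LINT t|lborel. (f' t)\<^sup>2 * indicator {x..y} t)"
      by (rule integral_indicator_DERIV(2)[OF le G CG, symmetric])
    also have "\<dots> \<le> (LINT t|lborel. (f' t)\<^sup>2)"
      by (intro integral_mono integral_indicator_DERIV(1)[OF le G CG] csc_integrable csc_square assms)
        (auto simp: indicator_def)
    finally show ?thesis using h by (simp add: power2_commute[of "f x"] mult_right_mono)
  qed simp
next
  case (sym x y)
  then show ?case by (simp add: power2_commute abs_minus_commute)
qed

text \<open>Arzela-Ascoli with a square-root modulus: a diagonal subsequence converges on the
  rationals, and the common modulus carries the convergence to every real and makes the limit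
  continuous. Pointwise convergence is enough, since limits are later taken under the integral by
  domination or by Fatou.\<close>

lemma holder_subsequence:
  fixes F :: "nat \<Rightarrow> real \<Rightarrow> real"
  assumes bd: "\<And>n x. \<bar>F n x\<bar> \<le> M" and hl: "\<And>n x y. (F n x - F n y)\<^sup>2 \<le> K * \<bar>x - y\<bar>"
  obtains \<sigma> G where "strict_mono (\<sigma> :: nat \<Rightarrow> nat)" "\<And>x. (\<lambda>n. F (\<sigma> n) x) \<longlonglongrightarrow> G x"
    "continuous_on UNIV G"
proof -
  obtain \<sigma> where \<sigma>: "strict_mono (\<sigma> :: nat \<Rightarrow> nat)"
      "\<And>x. x \<in> \<rat> \<Longrightarrow> \<exists>l. (\<lambda>n. F (\<sigma> n) x) \<longlonglongrightarrow> l"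
    using function_convergent_subsequence[OF countable_rat, of F M] bd by auto
  have K: "K \<ge> 0" using hl[of 0 1 0] by (smt (verit) abs_zero diff_0_right mult_cancel_left2 zero_le_power2 abs_one)
  have small: "\<exists>d>0. \<forall>n x y. \<bar>x - y\<bar> < d \<longrightarrow> \<bar>F n x - F n y\<bar> < e" if "e > 0" for e
  \<comment> \<open>The square-root modulus inverts to \<open>e\<^sup>2 / K\<close>; adding 1 covers
    \<open>K = 0\<close>.\<close>
  proof (intro exI[of _ "e\<^sup>2 / (K + 1)"] conjI allI impI)
    show "e\<^sup>2 / (K + 1) > 0" using that K by simp
    fix n x y assume "\<bar>x - y\<bar> < e\<^sup>2 / (K + 1)"
    then have "\<bar>x - y\<bar> * (K + 1) < e\<^sup>2" using K by (simp add: field_simps)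
    then have "K * \<bar>x - y\<bar> < e\<^sup>2" using K by (auto simp: algebra_simps)
    then have "(F n x - F n y)\<^sup>2 < e\<^sup>2" using hl[of n x y] by linarith
    then show "\<bar>F n x - F n y\<bar> < e" using that power2_less_imp_less[of "\<bar>F n x - F n y\<bar>" e] by simp
  qed
  have "convergent (\<lambda>n. F (\<sigma> n) x)" for x
  proof (rule Cauchy_convergent, rule CauchyI)
    fix e :: real assume "e > 0"
    then obtain d where d: "d > 0" "\<And>n x y. \<bar>x - y\<bar> < d \<Longrightarrow> \<bar>F n x - F n y\<bar> < e / 3"
      using small[of "e / 3"] by auto
    obtain q where q: "q \<in> \<rat>" "x < q" "q < x + d" using Rats_dense_in_real[of x "x + d"] d by auto
    have "Cauchy (\<lambda>n. F (\<sigma> n) q)" using \<sigma>(2)[OF q(1)] LIMSEQ_imp_Cauchy by blast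
    then obtain N where N: "\<And>m n. m \<ge> N \<Longrightarrow> n \<ge> N \<Longrightarrow> \<bar>F (\<sigma> m) q - F (\<sigma> n) q\<bar> < e / 3"
      using CauchyD[of _ "e / 3"] \<open>e > 0\<close> by (metis divide_pos_pos real_norm_def zero_less_numeral)
    have "\<bar>F (\<sigma> m) x - F (\<sigma> n) x\<bar> < e" if "m \<ge> N" "n \<ge> N" for m n
      using d(2)[of x q "\<sigma> m"] d(2)[of x q "\<sigma> n"] N[OF that] q by linarith
    then show "\<exists>N. \<forall>m\<ge>N. \<forall>n\<ge>N. norm (F (\<sigma> m) x - F (\<sigma> n) x) < e" by auto
  qed
  then have lim: "(\<lambda>n. F (\<sigma> n) x) \<longlonglongrightarrow> lim (\<lambda>n. F (\<sigma> n) x)" for x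
    by (simp add: convergent_LIMSEQ_iff)
  define G where "G = (\<lambda>x. lim (\<lambda>n. F (\<sigma> n) x))"
  have G: "(\<lambda>n. F (\<sigma> n) x) \<longlonglongrightarrow> G x" for x
    using lim by (simp add: G_def)
  have "continuous_on UNIV G"
  proof (clarsimp simp: continuous_on_iff dist_real_def)
    fix x e :: real assume "e > 0"
    then obtain d where d: "d > 0" "\<And>n x y. \<bar>x - y\<bar> < d \<Longrightarrow> \<bar>F n x - F n y\<bar> < e / 2"
      using small[of "e / 2"] by auto
    have "\<bar>G y - G x\<bar> \<le> e / 2" if "\<bar>y - x\<bar> < d" for y
    proof (rule LIMSEQ_le_const2)
      show "(\<lambda>n. \<bar>F (\<sigma> n) y - F (\<sigma> n) x\<bar>) \<longlonglongrightarrow> \<bar>G y - G x\<bar>"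
        by (intro tendsto_intros G)
      show "\<exists>N. \<forall>n\<ge>N. \<bar>F (\<sigma> n) y - F (\<sigma> n) x\<bar> \<le> e / 2"
        using d(2)[OF that] by (meson less_imp_le)
    qed
    then show "\<exists>d>0. \<forall>y. \<bar>y - x\<bar> < d \<longrightarrow> \<bar>G y - G x\<bar> < e"
      using d(1) \<open>e > 0\<close> by (intro exI[of _ d]) force
  qed
  then show ?thesis by (rule that[OF \<sigma>(1) G])
qed

section \<open>Jets of test functions and the du Bois-Reymond lemma\<close>

text \<open>A test function is carried along with its derivatives, as the sequence \<open>u 0, u 1, \<dots>, u n\<close>;
  the entries beyond \<open>n\<close> are irrelevant.\<close>

definition jet :: "nat \<Rightarrow> (nat \<Rightarrow> real \<Rightarrow> real) \<Rightarrow> bool" where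
  "jet n u \<longleftrightarrow> (\<forall>i<n. \<forall>x. (u i has_real_derivative u (Suc i) x) (at x)) \<and> (\<forall>i\<le>n. csc (u i))"

lemma jet_DERIV: "jet n u \<Longrightarrow> i < n \<Longrightarrow> (u i has_real_derivative u (Suc i) x) (at x)"
  by (simp add: jet_def)

lemma jet_csc: "jet n u \<Longrightarrow> i \<le> n \<Longrightarrow> csc (u i)"
  by (simp add: jet_def)

lemma jet_mono: "jet n u \<Longrightarrow> m \<le> n \<Longrightarrow> jet m u"
  by (simp add: jet_def)

lemma jet_add: "jet n u \<Longrightarrow> jet n v \<Longrightarrow> jet n (\<lambda>i x. u i x + v i x)"
  by (auto simp: jet_def intro!: csc_add derivative_intros)

lemma jet_cmult: "jet n u \<Longrightarrow> jet n (\<lambda>i x. c * u i x)"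
  by (auto simp: jet_def intro!: csc_cmult derivative_eq_intros)

text \<open>Serves both to build cutoff jets order by order and to exhibit a jet of mean zero as the
  derivative of a longer one.\<close>

lemma jet_Cons:
  assumes "jet n u" "csc f" "\<And>x. (f has_real_derivative u 0 x) (at x)"
  shows "jet (Suc n) (case_nat f u)"
  unfolding jet_def
proof (intro conjI allI impI)
  fix i x assume "i < Suc n"
  then show "(case_nat f u i has_real_derivative case_nat f u (Suc i) x) (at x)"
    using assms by (cases i) (auto simp: jet_def)
next
  fix i assume "i \<le> Suc n"
  then show "csc (case_nat f u i)" using assms by (cases i) (auto simp: jet_def)
qed

section \<open>Polynomial cutoffs\<close>

lemma DERIV_max0_power:
  assumes "m \<ge> 2"
  shows "((\<lambda>t::real. (max 0 t) ^ m) has_real_derivative real m * (max 0 t) ^ (m - 1)) (at t)"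
proof -
  consider "t > 0" | "t < 0" | "t = 0" by linarith
  then show ?thesis
  proof cases
    case 1
    have "((\<lambda>t::real. t ^ m) has_real_derivative real m * t ^ (m - 1)) (at t)"
      by (auto intro!: derivative_eq_intros)
    then have "((\<lambda>t::real. (max 0 t) ^ m) has_real_derivative real m * t ^ (m - 1)) (at t)"
      by (rule has_field_derivative_transform_within_open[where S="{0<..}"]) (use 1 in auto)
    then show ?thesis using 1 by simp
  next
    case 2
    have "((\<lambda>t::real. 0) has_real_derivative 0) (at t)" by simp
    then have "((\<lambda>t::real. (max 0 t) ^ m) has_real_derivative 0) (at t)"
      by (rule has_field_derivative_transform_within_open[where S="{..<0}"]) (use 2 assms in \<open>auto simp: max_def\<close>)
    then show ?thesis using 2 assms by (simp add: max_absorb1 power_0_left)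
  next
    case 3
    \<comment> \<open>The corner at 0 disappears because \<open>m - 1 > 0\<close>: the difference
      quotient is at most \<open>\<bar>h\<bar> ^ (m - 1)\<close>, which tends to 0.\<close>
    have le: "\<bar>max 0 h ^ m / h\<bar> \<le> \<bar>h\<bar> ^ (m - 1)" for h :: real
    proof (cases "h > 0")
      case True
      obtain l where "m = Suc l" using assms by (cases m) auto
      then have "max 0 h ^ m / h = h ^ (m - 1)" using True by (simp add: max_absorb2)
      then show ?thesis using True by simp
    next
      case False
      then show ?thesis using assms by (simp add: max_absorb1 power_0_left)
    qed
    have "(\<lambda>h::real. (max 0 h) ^ m / h) \<midarrow>0\<rightarrow> 0"
    proof (rule tendsto_rabs_zero_cancel, rule tendsto_sandwich[of "\<lambda>_. 0" _ _ "\<lambda>h. \<bar>h\<bar> ^ (m - 1)"])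
      show "\<forall>\<^sub>F h in at (0::real). \<bar>max 0 h ^ m / h\<bar> \<le> \<bar>h\<bar> ^ (m - 1)"
        by (rule always_eventually, rule allI, rule le)
      have "(\<lambda>h::real. \<bar>h\<bar> ^ (m - 1)) \<midarrow>0\<rightarrow> \<bar>0\<bar> ^ (m - 1)" by (intro tendsto_intros)
      then show "(\<lambda>h::real. \<bar>h\<bar> ^ (m - 1)) \<midarrow>0\<rightarrow> 0" using assms by (simp add: power_0_left)
    qed auto
    then show ?thesis using 3 assms by (simp add: DERIV_def power_0_left)
  qed
qed

text \<open>For \<open>R > 0\<close> and \<open>m > 0\<close> a cutoff of class C^(m-1), positive
  exactly on (-R, R). Its derivative is a multiple of x times the cutoff with exponent
  \<open>m - 1\<close>, so all derivatives that are needed stay explicit.\<close>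

definition bump :: "nat \<Rightarrow> real \<Rightarrow> real \<Rightarrow> real" where
  "bump m R x = (max 0 (1 - (x / R)\<^sup>2)) ^ m"

lemma bump_nonneg: "0 \<le> bump m R x" and bump_le_1: "bump m R x \<le> 1"
  by (auto simp: bump_def intro!: power_le_one)

lemma bump_pos: "R > 0 \<Longrightarrow> \<bar>x\<bar> < R \<Longrightarrow> 0 < bump m R x"
  by (auto simp: bump_def abs_square_less_1 intro!: zero_less_power)

lemma bump_tendsto_1: "(\<lambda>n. bump m (real (Suc n)) x) \<longlonglongrightarrow> 1"
proof -
  have "(\<lambda>n. x / real (Suc n)) \<longlonglongrightarrow> 0"
    by (rule LIMSEQ_Suc[OF lim_const_over_n])
  then have "(\<lambda>n. (max 0 (1 - (x / real (Suc n))\<^sup>2)) ^ m) \<longlonglongrightarrow> (max 0 (1 - 0\<^sup>2)) ^ m"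
    by (intro tendsto_intros)
  then show ?thesis by (simp add: bump_def)
qed

lemma csc_bump:
  assumes "R > 0" "m > 0" shows "csc (bump m R)"
  unfolding csc_def bump_def
proof (intro conjI exI[of _ R] allI impI continuous_intros)
  fix x assume "R < \<bar>x\<bar>"
  then have "1 < \<bar>x / R\<bar>" using assms by simp
  then have "1 \<le> (x / R)\<^sup>2" by (metis less_imp_le abs_square_less_1 not_less power2_abs)
  then show "max 0 (1 - (x / R)\<^sup>2) ^ m = 0" using assms by (simp add: max_def)
qed (use assms in auto)

lemma DERIV_bump:
  assumes "m \<ge> 2" "R > 0"
  shows "(bump m R has_real_derivative (- 2 * real m / R\<^sup>2) * (x * bump (m - 1) R x)) (at x)"
proof -
  have "((\<lambda>x. 1 - (x / R)\<^sup>2) has_real_derivative - (2 * x / R\<^sup>2)) (at x)"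
    using assms by (auto intro!: derivative_eq_intros simp: power2_eq_square)
  from DERIV_chain2[OF DERIV_max0_power[OF assms(1)] this] show ?thesis
    by (simp add: bump_def[abs_def] mult_ac)
qed

text \<open>The function is the derivative of \<open>bump 2 R\<close>; 2 is the least exponent for
  which the cutoff is continuously differentiable.\<close>

lemma csc_bump_2_derivative: "R > 0 \<Longrightarrow> csc (\<lambda>x. (- 4 / R\<^sup>2) * (x * bump 1 R x))"
  by (rule csc_cmult[OF csc_mult[OF continuous_on_id csc_bump]]) auto

text \<open>The monomial factor closes the family under differentiation: the derivative of x^j times
  a bump of exponent m combines x^(j-1) with exponent m and x^(j+1) with exponent m-1. Each
  derivative costs at most one exponent, hence \<open>n < m\<close>.\<close>

lemma monomial_bump_jet:
  assumes "n < m" "R > 0"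
  shows "\<exists>u. jet n u \<and> u 0 = (\<lambda>x. x ^ j * bump m R x)"
  using assms(1)
proof (induction n arbitrary: m j)
  case 0
  then show ?case
    using assms(2) by (intro exI[of _ "\<lambda>_ x. x ^ j * bump m R x"])
      (auto simp: jet_def intro!: csc_mult csc_bump continuous_intros)
next
  case (Suc n)
  have m1: "n < m - 1" using Suc.prems by simp
  \<comment> \<open>For \<open>j = 0\<close> the truncated \<open>j - 1\<close> is 0 as well, but
    this term then enters \<open>w\<close> with the factor \<open>real j = 0\<close>.\<close>
  obtain u where u: "jet n u" "u 0 = (\<lambda>x. x ^ (j - 1) * bump m R x)"
    using Suc.IH[of m "j - 1"] Suc.prems by auto
  obtain v where v: "jet n v" "v 0 = (\<lambda>x. x ^ Suc j * bump (m - 1) R x)"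
    using Suc.IH[of "m - 1" "Suc j"] m1 by blast
  define w where "w = (\<lambda>i x. real j * u i x + (- 2 * real m / R\<^sup>2) * v i x)"
  have "jet n w" unfolding w_def by (intro jet_add jet_cmult u v)
  moreover have "csc (\<lambda>x. x ^ j * bump m R x)"
    using Suc.prems assms(2) by (auto intro!: csc_mult csc_bump continuous_intros)
  moreover have "((\<lambda>x. x ^ j * bump m R x) has_real_derivative w 0 x) (at x)" for x
    using Suc.prems assms(2) unfolding w_def u(2) v(2)
    by (auto intro!: derivative_eq_intros DERIV_bump simp: algebra_simps)
  ultimately have "jet (Suc n) (case_nat (\<lambda>x. x ^ j * bump m R x) w)" by (rule jet_Cons)
  then show ?case by (intro exI[of _ "case_nat (\<lambda>x. x ^ j * bump m R x) w"]) simp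
qed

lemma bump_jet:
  assumes "n < m" "R > 0" obtains u where "jet n u" "u 0 = bump m R"
  using monomial_bump_jet[OF assms, of 0] by (auto simp: fun_eq_iff)

section \<open>The du Bois-Reymond lemma\<close>

lemma unit_mass_jet: obtains \<beta> where "jet n \<beta>" "(LINT x|lborel. \<beta> 0 x) = 1"
proof -
  obtain u where u: "jet n u" "u 0 = bump (Suc n) 1" using bump_jet[of n "Suc n" 1] by auto
  have c: "csc (bump (Suc n) 1)" by (simp add: csc_bump)
  have "(LINT x|lborel. bump (Suc n) 1 x) \<noteq> 0"
    using continuous_integral_zero[OF csc_continuous[OF c] csc_integrable[OF c] bump_nonneg, of 0]
      bump_pos[of 1 0 "Suc n"] by auto
  then have "(LINT x|lborel. (1 / (LINT x|lborel. bump (Suc n) 1 x)) * u 0 x) = 1"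
    by (simp add: u(2))
  with jet_cmult[OF u(1)] that show ?thesis by blast
qed

text \<open>Subtracting from \<open>u\<close> the multiple of a unit-mass jet \<open>\<beta>\<close>
  with the same mean leaves a jet of mean zero, that is, the derivative of a longer one, which the
  hypothesis annihilates. So the pairing sees \<open>u\<close> only through its mean, and
  \<open>c\<close> is the pairing with \<open>\<beta>\<close>.\<close>

lemma du_Bois_Reymond_step:
  assumes w: "continuous_on UNIV w" and 0: "\<forall>v. jet (Suc n) v \<longrightarrow> (LINT x|lborel. w x * v (Suc n) x) = 0"
  shows "\<exists>c. \<forall>u. jet n u \<longrightarrow> (LINT x|lborel. w x * u n x) = c * (LINT x|lborel. u 0 x)"
proof -
  obtain \<beta> where \<beta>: "jet n \<beta>" "(LINT x|lborel. \<beta> 0 x) = 1" by (rule unit_mass_jet)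
  have "(LINT x|lborel. w x * u n x) = (LINT x|lborel. w x * \<beta> n x) * (LINT x|lborel. u 0 x)"
    if u: "jet n u" for u
  proof -
    define m where "m = (LINT x|lborel. u 0 x)"
    define d where "d = (\<lambda>i x. u i x + (- m) * \<beta> i x)"
    have d: "jet n d" unfolding d_def by (intro jet_add jet_cmult u \<beta>)
    have "(LINT x|lborel. d 0 x) = (LINT x|lborel. u 0 x) + (LINT x|lborel. (- m) * \<beta> 0 x)"
      unfolding d_def using u \<beta>
      by (intro Bochner_Integration.integral_add csc_integrable csc_cmult jet_csc) auto
    then have "(LINT x|lborel. d 0 x) = 0" by (simp add: \<beta> m_def)
    then obtain F where F: "csc F" "\<And>x. (F has_real_derivative d 0 x) (at x)"
      using csc_antiderivative[of "d 0"] jet_csc[OF d] by auto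
    have "(LINT x|lborel. w x * case_nat F d (Suc n) x) = 0" using 0 jet_Cons[OF d F] by blast
    then have "(LINT x|lborel. w x * u n x + (- m) * (w x * \<beta> n x)) = 0"
      by (simp add: d_def algebra_simps)
    moreover have "(LINT x|lborel. w x * u n x + (- m) * (w x * \<beta> n x))
        = (LINT x|lborel. w x * u n x) + (LINT x|lborel. (- m) * (w x * \<beta> n x))"
      using u \<beta> w
      by (intro Bochner_Integration.integral_add csc_integrable csc_cmult csc_mult jet_csc) auto
    ultimately show ?thesis by (simp add: m_def)
  qed
  then show ?thesis by blast
qed

lemma jet_by_parts:
  assumes "\<And>x. (f has_real_derivative f' x) (at x)" "continuous_on UNIV f'" "jet n v" "i < n"
  shows "(LINT x|lborel. f x * v (Suc i) x) = - (LINT x|lborel. f' x * v i x)"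
  using assms by (intro integral_by_parts_csc) (auto simp: jet_def)

lemma integral_minus_csc:
  assumes "continuous_on UNIV f" "continuous_on UNIV h" "csc v"
  shows "(LINT x|lborel. (f x - h x) * v x) = (LINT x|lborel. f x * v x) - (LINT x|lborel. h x * v x)"
proof -
  have "(LINT x|lborel. (f x - h x) * v x) = (LINT x|lborel. f x * v x - h x * v x)"
    by (simp add: algebra_simps)
  also have "\<dots> = (LINT x|lborel. f x * v x) - (LINT x|lborel. h x * v x)"
    using assms by (intro Bochner_Integration.integral_diff csc_integrable csc_mult)
  finally show ?thesis .
qed

text \<open>Testing with \<open>w\<close> times a cutoff positive at \<open>x\<close> makes the
  integrand a nonnegative multiple of the square of \<open>w\<close>.\<close>

lemma du_Bois_Reymond_0:
  assumes w: "continuous_on UNIV w" and 0: "\<And>v. csc v \<Longrightarrow> (LINT x|lborel. w x * v x) = 0"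
  shows "w x = 0"
proof -
  define \<eta> where "\<eta> = bump 1 (\<bar>x\<bar> + 1)"
  have c: "csc (\<lambda>y. w y * \<eta> y)" using w unfolding \<eta>_def by (intro csc_mult csc_bump) auto
  then have c2: "csc (\<lambda>y. w y * (w y * \<eta> y))" by (rule csc_mult[OF w])
  have "0 \<le> w y * (w y * \<eta> y)" for y
    by (simp add: \<eta>_def bump_nonneg mult.assoc[symmetric])
  from continuous_integral_zero[OF csc_continuous[OF c2] csc_integrable[OF c2] this 0[OF c]]
  have "w x * (w x * \<eta> x) = 0" .
  moreover have "\<eta> x > 0" unfolding \<eta>_def by (intro bump_pos) auto
  ultimately show ?thesis by simp
qed

text \<open>Each step lowers the order by one and leaves a constant, which is removed by subtracting
  the monomial that reproduces it under integration by parts: \<open>c / 2 * x\<^sup>2\<close> after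
  two integrations, then \<open>(- b) * x\<close> after a single one, hence the sign, and finally
  the constant \<open>a\<close>.\<close>

lemma du_Bois_Reymond_3:
  assumes w: "continuous_on UNIV w" and 0: "\<And>v. jet 3 v \<Longrightarrow> (LINT x|lborel. w x * v 3 x) = 0"
  obtains a b c where "\<And>x. w x = a + b * x + c * x\<^sup>2"
proof -
  have "\<forall>v. jet (Suc 2) v \<longrightarrow> (LINT x|lborel. w x * v (Suc 2) x) = 0"
    using 0 by (simp add: numeral_3_eq_3 numeral_2_eq_2)
  from du_Bois_Reymond_step[OF w this] obtain c
    where c: "\<And>u. jet 2 u \<Longrightarrow> (LINT x|lborel. w x * u 2 x) = c * (LINT x|lborel. u 0 x)" by blast
  define w2 where "w2 = (\<lambda>x. w x - c / 2 * x\<^sup>2)"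
  have w2: "continuous_on UNIV w2" unfolding w2_def by (intro continuous_intros w)
  have "(LINT x|lborel. w2 x * v (Suc 1) x) = 0" if "jet (Suc 1) v" for v
  proof -
    have v: "jet 2 v" using that by (simp add: numeral_2_eq_2)
    have "(LINT x|lborel. (c / 2 * x\<^sup>2) * v (Suc 1) x) = - (LINT x|lborel. (c * x) * v 1 x)"
      by (rule jet_by_parts[OF _ _ v]) (auto intro!: derivative_eq_intros continuous_intros)
    also have "(LINT x|lborel. (c * x) * v 1 x) = - (LINT x|lborel. c * v 0 x)"
      unfolding One_nat_def
      by (rule jet_by_parts[OF _ _ v]) (auto intro!: derivative_eq_intros continuous_intros)
    finally have "(LINT x|lborel. (c / 2 * x\<^sup>2) * v (Suc 1) x) = c * (LINT x|lborel. v 0 x)"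
      by simp
    then show ?thesis using c[OF v] integral_minus_csc[OF w, of "\<lambda>x. c / 2 * x\<^sup>2" "v 2"] jet_csc[OF v, of 2]
      by (auto simp: w2_def continuous_intros numeral_2_eq_2)
  qed
  then have "\<forall>v. jet (Suc 1) v \<longrightarrow> (LINT x|lborel. w2 x * v (Suc 1) x) = 0" by blast
  from du_Bois_Reymond_step[OF w2 this] obtain b
    where b: "\<And>u. jet 1 u \<Longrightarrow> (LINT x|lborel. w2 x * u 1 x) = b * (LINT x|lborel. u 0 x)" by blast
  define w1 where "w1 = (\<lambda>x. w2 x - (- b) * x)"
  have w1: "continuous_on UNIV w1" unfolding w1_def by (intro continuous_intros w2)
  have "(LINT x|lborel. w1 x * v (Suc 0) x) = 0" if v: "jet (Suc 0) v" for v
  proof -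
    have "(LINT x|lborel. ((- b) * x) * v (Suc 0) x) = - (LINT x|lborel. (- b) * v 0 x)"
      by (rule jet_by_parts[OF _ _ v]) (auto intro!: derivative_eq_intros continuous_intros)
    then show ?thesis using b[of v] v integral_minus_csc[OF w2, of "\<lambda>x. (- b) * x" "v 1"] jet_csc[OF v, of 1]
      by (auto simp: w1_def continuous_intros)
  qed
  then have "\<forall>v. jet (Suc 0) v \<longrightarrow> (LINT x|lborel. w1 x * v (Suc 0) x) = 0" by blast
  from du_Bois_Reymond_step[OF w1 this] obtain a
    where a: "\<And>u. jet 0 u \<Longrightarrow> (LINT x|lborel. w1 x * u 0 x) = a * (LINT x|lborel. u 0 x)" by blast
  have "w1 x - a = 0" for x
  proof (rule du_Bois_Reymond_0[of "\<lambda>x. w1 x - a"])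
    show "continuous_on UNIV (\<lambda>x. w1 x - a)" by (intro continuous_intros w1)
    fix v assume v: "csc v"
    then have "jet 0 (\<lambda>_. v)" by (simp add: jet_def)
    from a[OF this] show "(LINT x|lborel. (w1 x - a) * v x) = 0"
      using integral_minus_csc[OF w1 continuous_on_const v, of a] by simp
  qed
  then have "w1 x = a" for x by (metis right_minus_eq)
  then have "w x = a + (- b) * x + (c / 2) * x\<^sup>2" for x
    unfolding w1_def w2_def by (simp add: algebra_simps) (metis add.commute diff_eq_eq mult.commute)
  then show ?thesis using that by blast
qed

section \<open>Square integrability through cutoffs\<close>

lemma cutoff_integrable_square:
  assumes f: "continuous_on UNIV f"
    and bound: "\<And>n. (LINT x|lborel. bump 2 (real (Suc n)) x * (f x)\<^sup>2) \<le> M"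
  shows "integrable lborel (\<lambda>x. (f x)\<^sup>2)"
\<comment> \<open>The cutoffs tend to 1 pointwise, so a bound independent of the radius survives.
  Estimates can thus be made on integrals that are finite from the start, as absorption arguments
  require.\<close>
proof (rule fatou_integrable[where s = "\<lambda>n x. bump 2 (real (Suc n)) x * (f x)\<^sup>2"])
  show "(LINT x|lborel. bump 2 (real (Suc n)) x * (f x)\<^sup>2) \<le> M" for n
    by (rule bound)
  show "0 \<le> bump 2 (real (Suc n)) x * (f x)\<^sup>2" for n x
    by (intro mult_nonneg_nonneg bump_nonneg zero_le_power2)
  show "integrable lborel (\<lambda>x. bump 2 (real (Suc n)) x * (f x)\<^sup>2)" for n
    by (rule csc_integrable[OF csc_mult'[OF csc_bump continuous_on_power[OF f]]]) auto
  show "(\<lambda>x. (f x)\<^sup>2) \<in> borel_measurable lborel"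
    by (rule continuous_measurable[OF continuous_on_power[OF f]])
  show "(\<lambda>n. bump 2 (real (Suc n)) x * (f x)\<^sup>2) \<longlonglongrightarrow> (f x)\<^sup>2" for x
  proof -
    have "(\<lambda>n. bump 2 (real (Suc n)) x * (f x)\<^sup>2) \<longlonglongrightarrow> 1 * (f x)\<^sup>2"
      by (rule tendsto_mult[OF bump_tendsto_1 tendsto_const])
    then show ?thesis unfolding mult_1 .
  qed
qed

text \<open>Interpolation: integrating \<open>\<eta> f'\<^sup>2\<close> by parts, the cutoff \<open>\<eta> = (1 - (x/R)\<^sup>2)\<^sub>+\<^sup>2\<close> satisfies
  \<open>\<eta>'\<^sup>2 \<le> 16 \<eta> / R\<^sup>2\<close>, so that the commutator term is absorbed.\<close>

lemma interpolation_integrable: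
  assumes d: "\<And>x. (f has_real_derivative f1 x) (at x)" "\<And>x. (f1 has_real_derivative f2 x) (at x)"
    and c: "continuous_on UNIV f2"
    and i: "integrable lborel (\<lambda>x. (f x)\<^sup>2)" "integrable lborel (\<lambda>x. (f2 x)\<^sup>2)"
  shows "integrable lborel (\<lambda>x. (f1 x)\<^sup>2)"
proof -
  define I0 I2 where "I0 = (LINT x|lborel. (f x)\<^sup>2)" and "I2 = (LINT x|lborel. (f2 x)\<^sup>2)"
  have cf: "continuous_on UNIV f" "continuous_on UNIV f1" using d continuous_on_DERIV by blast+
  \<comment> \<open>Absorbing half of the left side leaves (17/2) \<open>I0\<close> + (1/2)
    \<open>I2\<close>, to be doubled. Here 17/2 = 8 + 1/2: the 8 comes from the commutator term and
    the 1/2 from the term with \<open>f2\<close>.\<close>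
  have bound: "(LINT x|lborel. bump 2 (real (Suc n)) x * (f1 x)\<^sup>2) \<le> 17 * I0 + I2" for n
  proof -
    define R where "R = real (Suc n)"
    have R: "R \<ge> 1" "R > 0" by (auto simp: R_def)
    define b b1 where "b = bump 2 R" and "b1 = (\<lambda>x. (- 4 / R\<^sup>2) * (x * bump 1 R x))"
    have b: "csc b" "csc b1" unfolding b_def b1_def using R
      by (simp_all only: csc_bump csc_bump_2_derivative zero_less_numeral)
    have db: "(b has_real_derivative b1 x) (at x)" for x
      using DERIV_bump[of 2 R x] R by (simp add: b_def b1_def)
    \<comment> \<open>\<open>R \<ge> 1\<close> discards the decay in the radius; only a bound
      uniform in \<open>n\<close> is needed.\<close>
    have b1_sq: "(b1 x)\<^sup>2 \<le> 16 * b x" for x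
    proof (cases "\<bar>x\<bar> \<le> R")
      case True
      have "(b1 x)\<^sup>2 = 16 * ((x / R)\<^sup>2 / R\<^sup>2) * b x"
        by (simp add: b1_def b_def bump_def power2_eq_square)
      moreover have "(x / R)\<^sup>2 / R\<^sup>2 \<le> 1"
      proof -
        have "(x / R)\<^sup>2 \<le> 1" using True R by (simp add: abs_square_le_1)
        moreover have "1 \<le> R\<^sup>2" using R by simp
        ultimately show ?thesis by (simp add: divide_le_eq)
      qed
      ultimately show ?thesis using bump_nonneg[of 2 R x]
        using mult_right_mono[of "(x / R)\<^sup>2 / R\<^sup>2" 1 "16 * b x"] by (simp add: b_def mult_ac)
    next
      case False
      then have "1 < \<bar>x / R\<bar>" using R by simp
      then have "1 \<le> (x / R)\<^sup>2" by (metis less_imp_le abs_square_less_1 not_less power2_abs)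
      then have "bump 1 R x = 0" by (simp add: bump_def)
      then show ?thesis using bump_nonneg[of 2 R x] by (simp add: b1_def b_def)
    qed
    have "(LINT x|lborel. f x * (b1 x * f1 x + b x * f2 x)) = - (LINT x|lborel. f1 x * (b x * f1 x))"
    proof (rule integral_by_parts_csc[OF d(1)])
      show "csc (\<lambda>x. b x * f1 x)" "csc (\<lambda>x. b1 x * f1 x + b x * f2 x)"
        by (intro csc_add csc_mult' b cf c)+
      show "((\<lambda>x. b x * f1 x) has_real_derivative b1 x * f1 x + b x * f2 x) (at x)" for x
        by (auto intro!: derivative_eq_intros db d)
    qed (rule cf)
    then have "(LINT x|lborel. b x * (f1 x)\<^sup>2) = (LINT x|lborel. - (f x * (b1 x * f1 x + b x * f2 x)))"
      by (simp add: power2_eq_square mult_ac)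
    also have "\<dots> \<le> (LINT x|lborel. (1/2) * (b x * (f1 x)\<^sup>2) + ((17/2) * (f x)\<^sup>2 + (1/2) * (f2 x)\<^sup>2))"
    proof (rule integral_mono)
      show "integrable lborel (\<lambda>x. - (f x * (b1 x * f1 x + b x * f2 x)))"
        by (intro csc_integrable csc_minus csc_mult[OF cf(1)] csc_add csc_mult' b cf c)
      show "integrable lborel (\<lambda>x. (1/2) * (b x * (f1 x)\<^sup>2) + ((17/2) * (f x)\<^sup>2 + (1/2) * (f2 x)\<^sup>2))"
      proof (intro Bochner_Integration.integrable_add integrable_mult_right i)
        show "integrable lborel (\<lambda>x. b x * (f1 x)\<^sup>2)"
          by (intro csc_integrable csc_mult'[OF b(1)] continuous_intros cf)
      qed
      fix x
      have b01: "0 \<le> b x" "b x \<le> 1" by (auto simp: b_def bump_nonneg bump_le_1)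
      have "- (f x * b x * f2 x) \<le> (1/2) * (f x)\<^sup>2 + (1/2) * (f2 x)\<^sup>2"
      proof -
        have "0 \<le> (f x + b x * f2 x)\<^sup>2" by simp
        then have "- (f x * b x * f2 x) \<le> (1/2) * (f x)\<^sup>2 + (1/2) * ((b x)\<^sup>2 * (f2 x)\<^sup>2)"
          by (simp add: power2_eq_square algebra_simps)
        moreover have "(b x)\<^sup>2 * (f2 x)\<^sup>2 \<le> 1 * (f2 x)\<^sup>2"
          using b01 by (intro mult_right_mono) (auto simp: power_le_one)
        ultimately show ?thesis by simp
      qed
      moreover have "- (f x * b1 x * f1 x) \<le> 8 * (f x)\<^sup>2 + (1/2) * (b x * (f1 x)\<^sup>2)"
      proof -
        \<comment> \<open>The arithmetic-geometric inequality in squared form: the weights satisfy 4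
          * 8 * (1/2) = 16, the constant of \<open>b1_sq\<close>, and 1/2 is small enough to
          absorb.\<close>
        have "(f x * b1 x * f1 x)\<^sup>2 \<le> 16 * b x * (f x)\<^sup>2 * (f1 x)\<^sup>2"
          using mult_right_mono[OF b1_sq[of x], of "(f x)\<^sup>2 * (f1 x)\<^sup>2"]
          by (simp add: power_mult_distrib mult_ac)
        also have "\<dots> \<le> (8 * (f x)\<^sup>2 + (1/2) * (b x * (f1 x)\<^sup>2))\<^sup>2"
        proof -
          have "0 \<le> (8 * (f x)\<^sup>2 - (1/2) * (b x * (f1 x)\<^sup>2))\<^sup>2" by simp
          then show ?thesis by (simp add: power2_eq_square algebra_simps)
        qed
        finally have "\<bar>f x * b1 x * f1 x\<bar> \<le> \<bar>8 * (f x)\<^sup>2 + (1/2) * (b x * (f1 x)\<^sup>2)\<bar>"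
          by (simp only: abs_le_square_iff)
        moreover have "0 \<le> b x * (f1 x)\<^sup>2" "0 \<le> (f x)\<^sup>2" using b01 by auto
        ultimately show ?thesis by (simp add: abs_le_iff)
      qed
      ultimately show "- (f x * (b1 x * f1 x + b x * f2 x))
          \<le> (1/2) * (b x * (f1 x)\<^sup>2) + ((17/2) * (f x)\<^sup>2 + (1/2) * (f2 x)\<^sup>2)"
        by (simp add: algebra_simps)
    qed
    also have "\<dots> = (1/2) * (LINT x|lborel. b x * (f1 x)\<^sup>2) + ((17/2) * I0 + (1/2) * I2)"
    proof -
      have "integrable lborel (\<lambda>x. b x * (f1 x)\<^sup>2)"
        using b cf by (intro csc_integrable csc_mult' continuous_intros)
      then show ?thesis using i by (simp add: I0_def I2_def)
    qed
    finally show ?thesis by (simp add: b_def R_def)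
  qed
  from cutoff_integrable_square[OF cf(2) bound] show ?thesis .
qed

lemma csc_abs: "csc f \<Longrightarrow> csc (\<lambda>x. \<bar>f x\<bar>)"
  unfolding csc_def by (auto intro: continuous_on_rabs)

text \<open>Lower semicontinuity by duality: \<open>\<integral> \<eta> f'\<^sup>2\<close> is the limit of \<open>\<integral> u\<^sub>n' \<eta> f'\<close>, where the derivative
  of \<open>u\<^sub>n\<close> has been moved onto \<open>\<eta> f'\<close> and back.\<close>

lemma limit_derivative_square_integrable:
  assumes u: "\<And>n x. (u n has_real_derivative u' n x) (at x)" "\<And>n. csc (u' n)"
      "\<And>n x. \<bar>u n x\<bar> \<le> B" "\<And>n. (LINT x|lborel. (u' n x)\<^sup>2) \<le> M"
    and lim: "\<And>x. (\<lambda>n. u n x) \<longlonglongrightarrow> f x"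
    and f: "\<And>x. (f has_real_derivative f1 x) (at x)" "\<And>x. (f1 has_real_derivative f2 x) (at x)"
    and cf2: "continuous_on UNIV f2"
  shows "integrable lborel (\<lambda>x. (f1 x)\<^sup>2)"
proof -
  have cf: "continuous_on UNIV f" "continuous_on UNIV f1" using f continuous_on_DERIV by blast+
  have cu: "continuous_on UNIV (u n)" "continuous_on UNIV (u' n)" for n
    using u(1) u(2) continuous_on_DERIV csc_continuous by blast+
  have bound: "(LINT x|lborel. bump 2 (real (Suc n)) x * (f1 x)\<^sup>2) \<le> M" for n
  proof -
    define R where "R = real (Suc n)"
    have R: "R > 0" by (auto simp: R_def)
    define e e1 where "e = bump 2 R" and "e1 = (\<lambda>x. (- 4 / R\<^sup>2) * (x * bump 1 R x))"
    have e: "csc e" "csc e1" unfolding e_def e1_def using R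
      by (simp_all only: csc_bump csc_bump_2_derivative zero_less_numeral)
    have de: "(e has_real_derivative e1 x) (at x)" for x
      using DERIV_bump[of 2 R x] R by (simp add: e_def e1_def)
    define z z1 where "z = (\<lambda>x. e x * f1 x)" and "z1 = (\<lambda>x. e1 x * f1 x + e x * f2 x)"
    have z: "csc z" "csc z1" unfolding z_def z1_def by (intro csc_add csc_mult' e cf cf2)+
    have dz: "(z has_real_derivative z1 x) (at x)" for x
      unfolding z_def z1_def by (auto intro!: derivative_eq_intros de f)
    have csq: "csc (\<lambda>x. e x * (f1 x)\<^sup>2)" by (intro csc_mult'[OF e(1)] continuous_intros cf)
    define I where "I = (LINT x|lborel. e x * (f1 x)\<^sup>2)"
    have "(\<lambda>j. LINT x|lborel. u j x * z1 x) \<longlonglongrightarrow> (LINT x|lborel. f x * z1 x)"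
    proof (rule integral_dominated_convergence[where w = "\<lambda>x. B * \<bar>z1 x\<bar>"])
      show "(\<lambda>x. f x * z1 x) \<in> borel_measurable lborel" "(\<lambda>x. u j x * z1 x) \<in> borel_measurable lborel" for j
        by (intro continuous_measurable continuous_on_mult cf cu csc_continuous z)+
      show "integrable lborel (\<lambda>x. B * \<bar>z1 x\<bar>)"
        by (intro csc_integrable csc_cmult csc_abs z)
      show "AE x in lborel. (\<lambda>j. u j x * z1 x) \<longlonglongrightarrow> f x * z1 x"
        by (intro always_eventually allI tendsto_intros lim)
      show "AE x in lborel. norm (u j x * z1 x) \<le> B * \<bar>z1 x\<bar>" for j
        by (intro always_eventually allI) (simp add: abs_mult mult_right_mono u(3))
    qed
    moreover have "(LINT x|lborel. u j x * z1 x) = - (LINT x|lborel. u' j x * z x)" for j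
      by (rule integral_by_parts_csc[OF u(1) cu(2) dz z])
    moreover have "(LINT x|lborel. f x * z1 x) = - (LINT x|lborel. f1 x * z x)"
      by (rule integral_by_parts_csc[OF f(1) cf(2) dz z])
    moreover have "(LINT x|lborel. f1 x * z x) = I"
      unfolding I_def z_def by (simp add: power2_eq_square mult_ac)
    ultimately have "(\<lambda>j. LINT x|lborel. u' j x * z x) \<longlonglongrightarrow> I"
      using tendsto_minus_cancel by fastforce
    \<comment> \<open>Young's inequality together with \<open>e\<^sup>2 \<le> e\<close>. The bound
      contains \<open>I\<close> itself with factor 1/2; in the limit this gives
      \<open>I \<le> M\<close>, since \<open>I\<close> is a finite number.\<close>
    moreover have "(LINT x|lborel. u' j x * z x) \<le> (1/2) * M + (1/2) * I" for j
    proof -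
      have "(LINT x|lborel. u' j x * z x)
          \<le> (LINT x|lborel. (1/2) * (u' j x)\<^sup>2 + (1/2) * (e x * (f1 x)\<^sup>2))"
      proof (rule integral_mono)
        show "integrable lborel (\<lambda>x. u' j x * z x)"
          by (rule csc_integrable[OF csc_mult[OF cu(2) z(1)]])
        show "integrable lborel (\<lambda>x. (1/2) * (u' j x)\<^sup>2 + (1/2) * (e x * (f1 x)\<^sup>2))"
          by (rule csc_integrable[OF csc_add[OF csc_cmult[OF csc_square[OF u(2)]] csc_cmult[OF csq]]])
        fix x
        have e01: "0 \<le> e x" "e x \<le> 1" by (auto simp: e_def bump_nonneg bump_le_1)
        have "0 \<le> (u' j x - e x * f1 x)\<^sup>2" by simp
        then have "u' j x * z x \<le> (1/2) * (u' j x)\<^sup>2 + (1/2) * ((e x * e x) * (f1 x)\<^sup>2)"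
          unfolding z_def by (simp add: power2_eq_square algebra_simps)
        moreover have "(e x * e x) * (f1 x)\<^sup>2 \<le> (e x * 1) * (f1 x)\<^sup>2"
          using e01 by (intro mult_right_mono mult_left_mono) auto
        ultimately show "u' j x * z x \<le> (1/2) * (u' j x)\<^sup>2 + (1/2) * (e x * (f1 x)\<^sup>2)" by simp
      qed
      also have "\<dots> = (1/2) * (LINT x|lborel. (u' j x)\<^sup>2) + (1/2) * I"
        using csc_integrable[OF csc_square[OF u(2)]] csc_integrable[OF csq] by (simp add: I_def)
      also have "\<dots> \<le> (1/2) * M + (1/2) * I" using u(4)[of j] by simp
      finally show ?thesis .
    qed
    ultimately have "I \<le> (1/2) * M + (1/2) * I" by (intro LIMSEQ_le_const2) auto
    then show ?thesis by (simp add: I_def e_def R_def)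
  qed
  from cutoff_integrable_square[OF cf(2) bound] show ?thesis .
qed

section \<open>Weak derivatives of smooth functions\<close>

lemma continuous_AE_zero:
  assumes "continuous_on UNIV f" "AE x in lborel. f x = (0::real)"
  shows "f (x::real) = 0"
proof (rule continuous_integral_zero[where f = "\<lambda>x. (f x)\<^sup>2", THEN zero_eq_power2[THEN iffD1]])
  have z: "AE x in lborel. (f x)\<^sup>2 = 0" using assms(2) by simp
  show "continuous_on UNIV (\<lambda>x. (f x)\<^sup>2)" by (intro continuous_intros assms)
  show "integrable lborel (\<lambda>x. (f x)\<^sup>2)"
    using z continuous_measurable[OF continuous_on_power[OF assms(1)]] by (subst integrable_cong_AE[where g = "\<lambda>_. 0"]) auto
  show "(LINT x|lborel. (f x)\<^sup>2) = 0"
    using z continuous_measurable[OF continuous_on_power[OF assms(1)]] by (subst integral_cong_AE[where g = "\<lambda>_. 0"]) auto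
qed simp

text \<open>One support radius serves all derivatives: a function vanishing on an open set has
  vanishing derivative there.\<close>

lemma test_function_jet:
  assumes "test_function \<psi>" shows "jet n (\<lambda>i. (deriv ^^ i) \<psi>)"
proof -
  define u where "u = (\<lambda>i. (deriv ^^ i) \<psi>)"
  have d: "(u i has_real_derivative u (Suc i) x) (at x)" for i x
    using assms by (auto simp: test_function_def u_def intro: field_differentiable_derivI)
  have "bounded (closure {x. \<psi> x \<noteq> 0})" using assms by (auto simp: test_function_def compact_imp_bounded)
  then have "bounded {x. \<psi> x \<noteq> 0}" using bounded_subset closure_subset by blast
  then obtain R where R: "\<And>x. \<psi> x \<noteq> 0 \<Longrightarrow> \<bar>x\<bar> \<le> R" by (auto simp: bounded_iff)
  have out: "u i x = 0" if "R < \<bar>x\<bar>" for i x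
    using that
  proof (induction i arbitrary: x)
    case 0
    then show ?case using R[of x] by (force simp: u_def)
  next
    case (Suc i)
    have "((\<lambda>x. 0) has_real_derivative u (Suc i) x) (at x)"
    proof (rule has_field_derivative_transform_within_open[OF d])
      show "open {x. R < \<bar>x\<bar>}" by (intro open_Collect_less continuous_intros)
    qed (use Suc in auto)
    then show ?case using DERIV_unique[OF _ DERIV_const] by blast
  qed
  then have "csc (u i)" for i
    unfolding csc_def using continuous_on_DERIV[OF d] by blast
  then show ?thesis using d by (simp add: jet_def u_def[symmetric])
qed

lemma continuous_locally_integrable: "continuous_on UNIV f \<Longrightarrow> locally_integrable f"
  unfolding locally_integrable_def set_integrable_def
  by (intro allI impI borel_integrable_compact) (auto intro: continuous_on_subset)

lemma weak_deriv_classical: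
  assumes d: "\<And>i x. i < n \<Longrightarrow> (u i has_real_derivative u (Suc i) x) (at x)"
    and c: "\<And>i. i \<le> n \<Longrightarrow> continuous_on UNIV (u i)"
  shows "weak_deriv n (u 0) (u n)"
  unfolding weak_deriv_def
proof (intro conjI allI impI continuous_locally_integrable c)
  fix \<psi> assume "test_function \<psi>"
  then have j: "jet n (\<lambda>i. (deriv ^^ i) \<psi>)" by (rule test_function_jet)
  \<comment> \<open>The invariant after moving \<open>i\<close> of the \<open>n\<close> derivatives
    off the test function; the case \<open>i = n\<close> is the claim.\<close>
  have "(LINT x|lborel. u 0 x * (deriv ^^ n) \<psi> x) = (-1) ^ i * (LINT x|lborel. u i x * (deriv ^^ (n - i)) \<psi> x)"
    if "i \<le> n" for i
    using that
  proof (induction i)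
    case (Suc i)
    then have s: "n - i = Suc (n - Suc i)" by simp
    have "(LINT x|lborel. u i x * (deriv ^^ (Suc (n - Suc i))) \<psi> x)
        = - (LINT x|lborel. u (Suc i) x * (deriv ^^ (n - Suc i)) \<psi> x)"
      by (rule jet_by_parts[OF d c j]) (use Suc.prems in auto)
    then show ?case using Suc by (simp only: s) simp
  qed simp
  from this[of n] show "(LINT x|lborel. u 0 x * (deriv ^^ n) \<psi> x) = (-1) ^ n * (LINT x|lborel. u n x * \<psi> x)"
    by simp
qed auto

lemma square_integrable_continuous:
  "continuous_on UNIV f \<Longrightarrow> integrable lborel (\<lambda>x. (f x)\<^sup>2) \<Longrightarrow> square_integrable f"
  by (simp add: square_integrable_def borel_measurable_continuous_onI)

lemma integrable_square_bounded_combination: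
  fixes A B D :: "real \<Rightarrow> real"
  assumes h: "continuous_on UNIV h" "\<And>x. h x = A x * f x + B x * f1 x + D x * f2 x"
    and bd: "\<And>x. \<bar>A x\<bar> \<le> c" "\<And>x. \<bar>B x\<bar> \<le> c" "\<And>x. \<bar>D x\<bar> \<le> c"
    and i: "integrable lborel (\<lambda>x. (f x)\<^sup>2)" "integrable lborel (\<lambda>x. (f1 x)\<^sup>2)" "integrable lborel (\<lambda>x. (f2 x)\<^sup>2)"
  shows "integrable lborel (\<lambda>x. (h x)\<^sup>2)"
proof (rule Bochner_Integration.integrable_bound)
  show "integrable lborel (\<lambda>x. (3 * c\<^sup>2) * ((f x)\<^sup>2 + (f1 x)\<^sup>2 + (f2 x)\<^sup>2))" using i by simp
  show "(\<lambda>x. (h x)\<^sup>2) \<in> borel_measurable lborel" by (rule continuous_measurable[OF continuous_on_power[OF h(1)]])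
  show "AE x in lborel. norm ((h x)\<^sup>2) \<le> norm ((3 * c\<^sup>2) * ((f x)\<^sup>2 + (f1 x)\<^sup>2 + (f2 x)\<^sup>2))"
  proof (intro always_eventually allI)
    fix x
    have c: "(A x)\<^sup>2 \<le> c\<^sup>2" "(B x)\<^sup>2 \<le> c\<^sup>2" "(D x)\<^sup>2 \<le> c\<^sup>2"
      using bd[of x] by (metis abs_ge_zero power2_abs power_mono)+
    have three: "(p + q + s)\<^sup>2 \<le> 3 * (p\<^sup>2 + q\<^sup>2 + s\<^sup>2)" for p q s :: real
    proof -
      have "0 \<le> (p - q)\<^sup>2 + (q - s)\<^sup>2 + (p - s)\<^sup>2" by simp
      then show ?thesis by (simp add: power2_eq_square algebra_simps)
    qed
    have "(h x)\<^sup>2 \<le> 3 * ((A x)\<^sup>2 * (f x)\<^sup>2 + (B x)\<^sup>2 * (f1 x)\<^sup>2 + (D x)\<^sup>2 * (f2 x)\<^sup>2)"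
      using three[of "A x * f x" "B x * f1 x" "D x * f2 x"] by (simp add: h(2) power_mult_distrib)
    also have "\<dots> \<le> 3 * (c\<^sup>2 * (f x)\<^sup>2 + c\<^sup>2 * (f1 x)\<^sup>2 + c\<^sup>2 * (f2 x)\<^sup>2)"
      using c by (intro mult_left_mono add_mono mult_right_mono) auto
    finally show "norm ((h x)\<^sup>2) \<le> norm ((3 * c\<^sup>2) * ((f x)\<^sup>2 + (f1 x)\<^sup>2 + (f2 x)\<^sup>2))"
      by (simp add: algebra_simps)
  qed
qed

section \<open>The variational problem\<close>

lemma nonneg_quadratic_discriminant:
  fixes a b c :: real
  assumes "\<And>t. 0 \<le> a + 2 * t * b + t\<^sup>2 * c" "c \<ge> 0"
  shows "b\<^sup>2 \<le> a * c"
proof (cases "c = 0")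
  case True
  have "b = 0"
  proof (rule ccontr)
    assume "b \<noteq> 0"
    \<comment> \<open>For \<open>c = 0\<close> the polynomial is affine in \<open>t\<close>, and
      this \<open>t\<close> would give it the value -1.\<close>
    then have "2 * (- (a + 1) / (2 * b)) * b = - (a + 1)" by (simp add: field_simps)
    then show False using assms(1)[of "- (a + 1) / (2 * b)"] True by simp
  qed
  then show ?thesis using True by simp
next
  case False
  then have "0 \<le> a + 2 * (- b / c) * b + (- b / c)\<^sup>2 * c" using assms(1) by blast
  also have "\<dots> = a - b\<^sup>2 / c" using False by (simp add: power2_eq_square)
  finally show ?thesis using False assms(2) by (simp add: divide_le_eq mult.commute)
qed

lemma jet_integrable_square:
  assumes "jet n u" "i \<le> n" shows "integrable lborel (\<lambda>x. (u i x)\<^sup>2)"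
  using assms by (intro csc_integrable csc_square jet_csc)

text \<open>\<open>r\<close> is the derivative of the density, and \<open>K\<close> will be the
  supremum of \<open>r / \<rho>\<close>, the inverse of \<open>L0\<close>. Integrability of
  \<open>r\<close> provides the domination that prevents loss of buoyancy at infinity.\<close>

locale stratification =
  fixes g \<mu> k a b m K :: real and \<rho> r :: "real \<Rightarrow> real"
  assumes pos: "g > 0" "\<mu> > 0" "k > 0" "a > 0"
    and d\<rho>: "\<And>x. (\<rho> has_real_derivative r x) (at x)"
    and cr: "continuous_on UNIV r"
    and r: "\<And>x. 0 < r x" "\<And>x. r x \<le> m" "\<And>x. r x \<le> K * \<rho> x" "integrable lborel r"
    and \<rho>: "\<And>x. a \<le> \<rho> x" "\<And>x. \<rho> x \<le> b"
begin

lemma c\<rho>: "continuous_on UNIV \<rho>"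
  using d\<rho> by (rule continuous_on_DERIV)

lemma \<rho>_pos: "0 < \<rho> x"
  using \<rho>(1)[of x] pos by linarith

text \<open>The polarized integrand of \<open>L\<^sup>2\<close> times the kinetic plus
  \<open>L\<close> times the viscous form. The second bracket is the fourth-order operator after
  integration by parts.\<close>

definition energy_density :: "real \<Rightarrow> (nat \<Rightarrow> real \<Rightarrow> real) \<Rightarrow> (nat \<Rightarrow> real \<Rightarrow> real) \<Rightarrow> real \<Rightarrow> real" where
  "energy_density L u v x = L\<^sup>2 * (\<rho> x * (k\<^sup>2 * (u 0 x * v 0 x) + u 1 x * v 1 x))
     + (L * \<mu>) * (u 2 x * v 2 x + (2 * k\<^sup>2) * (u 1 x * v 1 x) + k ^ 4 * (u 0 x * v 0 x))"

definition buoyancy_density :: "(nat \<Rightarrow> real \<Rightarrow> real) \<Rightarrow> (nat \<Rightarrow> real \<Rightarrow> real) \<Rightarrow> real \<Rightarrow> real" where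
  "buoyancy_density u v x = (g * k\<^sup>2) * (r x * (u 0 x * v 0 x))"

definition energy :: "real \<Rightarrow> (nat \<Rightarrow> real \<Rightarrow> real) \<Rightarrow> (nat \<Rightarrow> real \<Rightarrow> real) \<Rightarrow> real" where
  "energy L u v = (LINT x|lborel. energy_density L u v x)"

definition buoyancy :: "(nat \<Rightarrow> real \<Rightarrow> real) \<Rightarrow> (nat \<Rightarrow> real \<Rightarrow> real) \<Rightarrow> real" where
  "buoyancy u v = (LINT x|lborel. buoyancy_density u v x)"

lemma csc_energy_density:
  assumes "jet 2 u" "jet 2 v" shows "csc (energy_density L u v)"
proof -
  have uv: "csc (\<lambda>x. u i x * v i x)" if "i \<le> 2" for i
    using assms that by (intro csc_mult csc_continuous jet_csc[of 2])
  have "csc (\<lambda>x. k\<^sup>2 * (u 0 x * v 0 x) + u 1 x * v 1 x)"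
    by (rule csc_add[OF csc_cmult[OF uv] uv]) auto
  from csc_mult[OF c\<rho> this]
  have 1: "csc (\<lambda>x. \<rho> x * (k\<^sup>2 * (u 0 x * v 0 x) + u 1 x * v 1 x))" .
  have 2: "csc (\<lambda>x. u 2 x * v 2 x + (2 * k\<^sup>2) * (u 1 x * v 1 x) + k ^ 4 * (u 0 x * v 0 x))"
    by (rule csc_add[OF csc_add[OF uv csc_cmult[OF uv]] csc_cmult[OF uv]]) auto
  show ?thesis unfolding energy_density_def[abs_def] by (rule csc_add[OF csc_cmult[OF 1] csc_cmult[OF 2]])
qed

lemma csc_buoyancy_density:
  assumes "jet 2 u" "jet 2 v" shows "csc (buoyancy_density u v)"
  unfolding buoyancy_density_def[abs_def]
  by (rule csc_cmult[OF csc_mult[OF cr csc_mult[OF csc_continuous]]])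
    (use assms in \<open>auto intro: jet_csc\<close>)

lemmas energy_density_integrable = csc_integrable[OF csc_energy_density]
lemmas buoyancy_density_integrable = csc_integrable[OF csc_buoyancy_density]

lemma energy_density_diag:
  "energy_density L u u x = L\<^sup>2 * (\<rho> x * (k\<^sup>2 * (u 0 x)\<^sup>2 + (u 1 x)\<^sup>2))
     + (L * \<mu>) * ((u 2 x)\<^sup>2 + (2 * k\<^sup>2) * (u 1 x)\<^sup>2 + k ^ 4 * (u 0 x)\<^sup>2)"
  by (simp add: energy_density_def power2_eq_square)

lemma buoyancy_density_diag: "buoyancy_density u u x = (g * k\<^sup>2) * (r x * (u 0 x)\<^sup>2)"
  by (simp add: buoyancy_density_def power2_eq_square)

lemma energy_density_parts_nonneg:
  "0 \<le> \<rho> x * (k\<^sup>2 * (u 0 x)\<^sup>2 + (u 1 x)\<^sup>2)"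
  "0 \<le> (u 2 x)\<^sup>2 + (2 * k\<^sup>2) * (u 1 x)\<^sup>2 + k ^ 4 * (u 0 x)\<^sup>2" for u :: "nat \<Rightarrow> real \<Rightarrow> real"
  using \<rho>_pos[of x] by (auto intro!: add_nonneg_nonneg mult_nonneg_nonneg)

lemma buoyancy_density_nonneg: "0 \<le> buoyancy_density u u x"
  unfolding buoyancy_density_diag using pos r(1)[of x] by (auto intro!: mult_nonneg_nonneg)

lemma energy_density_nonneg: "L > 0 \<Longrightarrow> 0 \<le> energy_density L u u x"
  unfolding energy_density_diag using energy_density_parts_nonneg[where u=u and x=x] pos
  by (intro add_nonneg_nonneg[OF mult_nonneg_nonneg mult_nonneg_nonneg]) auto

lemma energy_nonneg: "L > 0 \<Longrightarrow> 0 \<le> energy L u u"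
  unfolding energy_def by (intro Bochner_Integration.integral_nonneg energy_density_nonneg)

lemma buoyancy_nonneg: "0 \<le> buoyancy u u"
  unfolding buoyancy_def by (intro Bochner_Integration.integral_nonneg buoyancy_density_nonneg)

text \<open>The kinetic part scales with \<open>t\<^sup>2\<close>, the viscous part with
  \<open>t\<close>, and \<open>t\<^sup>2 \<le> t\<close>. These two bounds stand in for continuity
  and monotonicity of the energy in the parameter.\<close>

lemma energy_scale:
  assumes "jet 2 u" "0 < t" "t \<le> 1" "L > 0"
  shows "t\<^sup>2 * energy L u u \<le> energy (t * L) u u" "energy (t * L) u u \<le> t * energy L u u"
proof -
  have pw: "t\<^sup>2 * energy_density L u u x \<le> energy_density (t * L) u u x \<and> energy_density (t * L) u u x \<le> t * energy_density L u u x" for x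
  proof -
    define A where "A = L\<^sup>2 * (\<rho> x * (k\<^sup>2 * (u 0 x)\<^sup>2 + (u 1 x)\<^sup>2))"
    define B where "B = (L * \<mu>) * ((u 2 x)\<^sup>2 + (2 * k\<^sup>2) * (u 1 x)\<^sup>2 + k ^ 4 * (u 0 x)\<^sup>2)"
    have AB: "A \<ge> 0" "B \<ge> 0" unfolding A_def B_def using energy_density_parts_nonneg[where u=u and x=x] assms pos
      by (auto intro!: mult_nonneg_nonneg)
    have t2: "t\<^sup>2 \<le> t" using assms by (simp add: power2_eq_square)
    have "energy_density L u u x = A + B" by (simp add: energy_density_diag A_def B_def)
    moreover have "energy_density (t * L) u u x = t\<^sup>2 * A + t * B"
      by (simp add: energy_density_diag A_def B_def power_mult_distrib)
    ultimately show ?thesis using mult_right_mono[OF t2 AB(1)] mult_right_mono[OF t2 AB(2)]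
      by (simp add: algebra_simps)
  qed
  have i: "integrable lborel (energy_density L u u)" "integrable lborel (energy_density (t * L) u u)"
    using assms by (auto intro: energy_density_integrable)
  have "(LINT x|lborel. t\<^sup>2 * energy_density L u u x) \<le> (LINT x|lborel. energy_density (t * L) u u x)"
    "(LINT x|lborel. energy_density (t * L) u u x) \<le> (LINT x|lborel. t * energy_density L u u x)"
    using pw by (intro integral_mono integrable_mult_right i; blast)+
  then show "t\<^sup>2 * energy L u u \<le> energy (t * L) u u" "energy (t * L) u u \<le> t * energy L u u"
    by (simp_all add: energy_def)
qed

section \<open>Normalization and the critical value\<close>

lemma energy_homogeneous: "energy L (\<lambda>i x. c * u i x) (\<lambda>i x. c * u i x) = c\<^sup>2 * energy L u u"
proof -
  have "energy_density L (\<lambda>i x. c * u i x) (\<lambda>i x. c * u i x) x = c\<^sup>2 * energy_density L u u x" for x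
    by (simp add: energy_density_def power2_eq_square algebra_simps)
  then show ?thesis by (simp add: energy_def)
qed

lemma buoyancy_homogeneous: "buoyancy (\<lambda>i x. c * u i x) (\<lambda>i x. c * u i x) = c\<^sup>2 * buoyancy u u"
proof -
  have "buoyancy_density (\<lambda>i x. c * u i x) (\<lambda>i x. c * u i x) x = c\<^sup>2 * buoyancy_density u u x" for x
    by (simp add: buoyancy_density_def power2_eq_square algebra_simps)
  then show ?thesis by (simp add: buoyancy_def)
qed

lemma jet_normalize:
  assumes "jet 3 u" "buoyancy u u > 0"
  obtains w where "jet 3 w" "buoyancy w w = 1" "\<And>L. energy L w w = energy L u u / buoyancy u u"
proof
  let ?c = "1 / sqrt (buoyancy u u)"
  have c: "?c\<^sup>2 = 1 / buoyancy u u" using assms(2) by (simp add: power_divide)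
  show "jet 3 (\<lambda>i x. ?c * u i x)" by (rule jet_cmult[OF assms(1)])
  show "buoyancy (\<lambda>i x. ?c * u i x) (\<lambda>i x. ?c * u i x) = 1"
    unfolding buoyancy_homogeneous c using assms(2) by simp
  show "energy L (\<lambda>i x. ?c * u i x) (\<lambda>i x. ?c * u i x) = energy L u u / buoyancy u u" for L
    unfolding energy_homogeneous c by simp
qed

lemma normalized_jet_exists: obtains u where "jet 3 u" "buoyancy u u = 1"
proof -
  obtain u where u: "jet 3 u" "u 0 = bump 4 1" using bump_jet[of 3 4 1] by auto
  have u2: "jet 2 u" using u(1) by (rule jet_mono) simp
  have "buoyancy u u \<noteq> 0"
  proof
    assume "buoyancy u u = 0"
    then have "buoyancy_density u u 0 = 0" unfolding buoyancy_def
      by (intro continuous_integral_zero[of "buoyancy_density u u"] csc_continuous csc_integrable csc_buoyancy_density u2 buoyancy_density_nonneg)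
    then show False using pos r(1)[of 0] bump_pos[of 1 0 4] by (simp add: buoyancy_density_def u(2))
  qed
  then have "buoyancy u u > 0" using buoyancy_nonneg[of u] by simp
  from jet_normalize[OF u(1) this] that show ?thesis by metis
qed

text \<open>\<open>L\<close> is the supremum of the set \<open>S\<close> of parameters at which some
  normalized test function has energy at most 1. Parameters above \<open>L\<close> give the
  inequality for all test functions, elements of \<open>S\<close> close to \<open>L\<close> give the
  near-minimizers.\<close>

lemma critical_value_exists:
  obtains L where "L > 0" "L\<^sup>2 \<le> g * K" "\<And>v. jet 3 v \<Longrightarrow> buoyancy v v \<le> energy L v v"
    "\<And>e. e > 0 \<Longrightarrow> \<exists>u. jet 3 u \<and> buoyancy u u = 1 \<and> energy L u u \<le> 1 + e"
proof -
  define S where "S = {L. L > 0 \<and> (\<exists>u. jet 3 u \<and> buoyancy u u = 1 \<and> energy L u u \<le> 1)}"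
  have K: "K > 0"
    using r(1)[of 0] r(3)[of 0] \<rho>_pos[of 0] by (metis less_le_trans zero_less_mult_pos2)
  have bd: "L\<^sup>2 \<le> g * K" if L_in: "L \<in> S" for L
  proof -
    obtain u where L: "L > 0" and u: "jet 3 u" "buoyancy u u = 1" "energy L u u \<le> 1"
      using L_in unfolding S_def by blast
    have u2: "jet 2 u" using u(1) by (rule jet_mono) simp
    \<comment> \<open>Pointwise, \<open>r \<le> K * \<rho>\<close> bounds the buoyancy density by
      the kinetic part of the energy density.\<close>
    have "g * K * energy L u u \<ge> L\<^sup>2 * buoyancy u u"
    proof -
      have "(LINT x|lborel. L\<^sup>2 * buoyancy_density u u x) \<le> (LINT x|lborel. (g * K) * energy_density L u u x)"
      proof (rule integral_mono)
        fix x
        have "L\<^sup>2 * buoyancy_density u u x = (g * L\<^sup>2 * (k\<^sup>2 * (u 0 x)\<^sup>2)) * r x"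
          by (simp add: buoyancy_density_diag)
        also have "\<dots> \<le> (g * L\<^sup>2 * (k\<^sup>2 * (u 0 x)\<^sup>2)) * (K * \<rho> x)"
          using pos by (intro mult_left_mono r) auto
        also have "\<dots> = (g * K) * (L\<^sup>2 * (\<rho> x * (k\<^sup>2 * (u 0 x)\<^sup>2)))"
          by simp
        also have "\<dots> \<le> (g * K) * (L\<^sup>2 * (\<rho> x * (k\<^sup>2 * (u 0 x)\<^sup>2 + (u 1 x)\<^sup>2)))"
          using pos K \<rho>_pos[of x] by (intro mult_left_mono) auto
        also have "\<dots> \<le> (g * K) * energy_density L u u x"
          using pos K L energy_density_parts_nonneg(2)[where u=u and x=x] unfolding energy_density_diag
          by (intro mult_left_mono) auto
        finally show "L\<^sup>2 * buoyancy_density u u x \<le> (g * K) * energy_density L u u x" .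
      qed (use energy_density_integrable[OF u2 u2] buoyancy_density_integrable[OF u2 u2] in auto)
      then show ?thesis by (simp add: energy_def buoyancy_def)
    qed
    moreover have "g * K * energy L u u \<le> g * K * 1" using pos K u by (intro mult_left_mono) auto
    ultimately show ?thesis using u by simp
  qed
  have bd': "L \<le> sqrt (g * K)" if "L \<in> S" for L
    using bd[OF that] by (rule real_le_rsqrt)
  have bdd: "bdd_above S" using bd' by (auto simp: bdd_above_def)
  obtain L0 where L0: "L0 \<in> S"
  proof -
    obtain u where u: "jet 3 u" "buoyancy u u = 1" by (rule normalized_jet_exists)
    have u2: "jet 2 u" using u(1) by (rule jet_mono) simp
    \<comment> \<open>Makes \<open>t * energy 1 u u \<le> 1\<close>, so the upper scaling bound puts
      \<open>t\<close> into \<open>S\<close>.\<close>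
    define t where "t = 1 / (1 + energy 1 u u)"
    have t: "0 < t" "t \<le> 1" using energy_nonneg[of 1 u] by (auto simp: t_def)
    have "energy t u u \<le> t * energy 1 u u" using energy_scale(2)[OF u2 t, of 1] by simp
    also have "\<dots> \<le> 1" using energy_nonneg[of 1 u] by (simp add: t_def)
    finally have "t \<in> S" using u t by (auto simp: S_def)
    then show ?thesis using that by blast
  qed
  define L where "L = Sup S"
  have Lub: "l \<le> L" if "l \<in> S" for l unfolding L_def using that bdd by (rule cSup_upper)
  have L: "L > 0" using Lub[OF L0] L0 by (auto simp: S_def)
  have "L \<le> sqrt (g * K)" unfolding L_def using L0 bd' by (intro cSup_least) auto
  then have L2: "L\<^sup>2 \<le> g * K" using L pos K
    by (metis less_imp_le mult_pos_pos real_sqrt_ge_0_iff real_sqrt_pow2 power_mono)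
  have low: "buoyancy v v \<le> energy L v v" if v: "jet 3 v" for v
  proof -
    have v2: "jet 2 v" using v by (rule jet_mono) simp
    \<comment> \<open>\<open>L / t\<close> exceeds the supremum, so normalized test functions have
      energy above 1 there. Scaling back to \<open>L\<close> costs the factor
      \<open>t\<^sup>2\<close>, which disappears as \<open>t\<close> tends to 1.\<close>
    have *: "t\<^sup>2 * buoyancy v v \<le> energy L v v" if t: "0 < t" "t < 1" for t
    proof (cases "buoyancy v v > 0")
      case True
      obtain w where w: "jet 3 w" "buoyancy w w = 1" "energy (L / t) w w = energy (L / t) v v / buoyancy v v"
        by (rule jet_normalize[OF v True]) blast
      have "L / t > L" using L t by (simp add: less_divide_eq)
      then have "L / t \<notin> S" using Lub[of "L / t"] by auto
      then have "energy (L / t) w w > 1" using w L t by (auto simp: S_def not_le)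
      then have "buoyancy v v < energy (L / t) v v" using w(3) True by simp
      moreover have "t\<^sup>2 * energy (L / t) v v \<le> energy L v v"
        using energy_scale(1)[OF v2, of t "L / t"] L t by simp
      moreover have "t\<^sup>2 > 0" using t by simp
      ultimately show ?thesis by (meson less_imp_le mult_left_mono order_trans)
    next
      case False
      then have "buoyancy v v = 0" using buoyancy_nonneg[of v] by simp
      then show ?thesis using energy_nonneg[OF L] by simp
    qed
    have "(\<lambda>t. t\<^sup>2 * buoyancy v v) \<midarrow>1\<rightarrow> 1\<^sup>2 * buoyancy v v" by (intro tendsto_intros)
    then have "((\<lambda>t. t\<^sup>2 * buoyancy v v) \<longlongrightarrow> buoyancy v v) (at_left 1)"
      by (simp add: filterlim_at_split)
    moreover have "eventually (\<lambda>t::real. 0 < t \<and> t < 1) (at_left 1)"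
      using eventually_at_left_real[of 0 "1::real"] by simp
    then have "eventually (\<lambda>t. t\<^sup>2 * buoyancy v v \<le> energy L v v) (at_left 1)"
      by eventually_elim (use * in auto)
    ultimately show ?thesis by (rule tendsto_upperbound) simp
  qed
  have "\<exists>u. jet 3 u \<and> buoyancy u u = 1 \<and> energy L u u \<le> 1 + e" if e: "e > 0" for e
  proof -
    \<comment> \<open>Chosen so that \<open>t\<^sup>2 = 1 / (1 + e)\<close>. An element
      \<open>l\<close> of \<open>S\<close> above \<open>t * L\<close> then gives, with
      \<open>s = l / L\<close>, the chain \<open>t\<^sup>2 * energy L u u \<le> s\<^sup>2 * energy L
      u u \<le> energy l u u \<le> 1\<close>.\<close>
    define t where "t = 1 / sqrt (1 + e)"
    have t: "0 < t" "t < 1" "t\<^sup>2 = 1 / (1 + e)" using e by (auto simp: t_def power_divide)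
    have "t * L < L" using L t by simp
    then obtain l where l: "l \<in> S" "t * L < l"
      using less_cSup_iff[OF _ bdd, of "t * L"] L0 unfolding L_def by blast
    obtain u where u: "jet 3 u" "buoyancy u u = 1" "energy l u u \<le> 1" using l by (auto simp: S_def)
    have u2: "jet 2 u" using u(1) by (rule jet_mono) simp
    define s where "s = l / L"
    have s: "t < s" "s \<le> 1" "s * L = l" using l Lub[OF l(1)] L by (auto simp: s_def less_divide_eq)
    have "t\<^sup>2 * energy L u u \<le> s\<^sup>2 * energy L u u"
      using s t energy_nonneg[OF L] by (intro mult_right_mono power_mono) auto
    also have "\<dots> \<le> 1" using energy_scale(1)[OF u2, of s L] s t L u(3) by simp
    finally have "energy L u u \<le> 1 + e" using e by (simp add: t(3) divide_le_eq)
    then show ?thesis using u by blast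
  qed
  with that[OF L L2 low] show ?thesis by blast
qed

text \<open>Coercivity comes from the viscous part, whose three coefficients are positive. The
  threshold 2 accommodates the energies 1 + 1/(n+1) of the maximizing sequence.\<close>

lemma energy_controls_derivatives:
  assumes "L > 0"
  obtains M where "M > 0" "\<And>u i. jet 3 u \<Longrightarrow> energy L u u \<le> 2 \<Longrightarrow> i \<le> 2 \<Longrightarrow> (LINT x|lborel. (u i x)\<^sup>2) \<le> M"
proof -
  define c where "c = L * \<mu> * min 1 (min (2 * k\<^sup>2) (k ^ 4))"
  have c: "c > 0" using assms pos by (simp add: c_def)
  have "(LINT x|lborel. (u i x)\<^sup>2) \<le> 2 / c" if u: "jet 3 u" "energy L u u \<le> 2" and i: "i \<le> 2" for u i
  proof -
    have u2: "jet 2 u" using u(1) by (rule jet_mono) simp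
    have "(LINT x|lborel. c * (u i x)\<^sup>2) \<le> (LINT x|lborel. energy_density L u u x)"
    proof (rule integral_mono)
      fix x
      have m: "min 1 (min (2 * k\<^sup>2) (k ^ 4)) * y \<le> y" "min 1 (min (2 * k\<^sup>2) (k ^ 4)) * y \<le> 2 * k\<^sup>2 * y"
        "min 1 (min (2 * k\<^sup>2) (k ^ 4)) * y \<le> k ^ 4 * y" if "y \<ge> 0" for y
        using mult_right_mono[OF _ that, of "min 1 (min (2 * k\<^sup>2) (k ^ 4))" 1]
          mult_right_mono[OF _ that, of "min 1 (min (2 * k\<^sup>2) (k ^ 4))" "2 * k\<^sup>2"]
          mult_right_mono[OF _ that, of "min 1 (min (2 * k\<^sup>2) (k ^ 4))" "k ^ 4"] by simp_all
      have nn: "0 \<le> (2 * k\<^sup>2) * (u 1 x)\<^sup>2" "0 \<le> k ^ 4 * (u 0 x)\<^sup>2" by simp_all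
      consider "i = 0" | "i = 1" | "i = 2" using i by linarith
      then have "min 1 (min (2 * k\<^sup>2) (k ^ 4)) * (u i x)\<^sup>2 \<le> (u 2 x)\<^sup>2 + (2 * k\<^sup>2) * (u 1 x)\<^sup>2 + k ^ 4 * (u 0 x)\<^sup>2"
      proof cases
        case 1
        show ?thesis unfolding 1
          using m(3)[OF zero_le_power2, of "u 0 x"] nn zero_le_power2[of "u 2 x"] by linarith
      next
        case 2
        show ?thesis unfolding 2
          using m(2)[OF zero_le_power2, of "u 1 x"] nn zero_le_power2[of "u 2 x"] by linarith
      next
        case 3
        show ?thesis unfolding 3 using m(1)[OF zero_le_power2, of "u 2 x"] nn by linarith
      qed
      then have "(L * \<mu>) * (min 1 (min (2 * k\<^sup>2) (k ^ 4)) * (u i x)\<^sup>2)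
          \<le> (L * \<mu>) * ((u 2 x)\<^sup>2 + (2 * k\<^sup>2) * (u 1 x)\<^sup>2 + k ^ 4 * (u 0 x)\<^sup>2)"
        using assms pos by (intro mult_left_mono) auto
      moreover have "0 \<le> L\<^sup>2 * (\<rho> x * (k\<^sup>2 * (u 0 x)\<^sup>2 + (u 1 x)\<^sup>2))"
        by (intro mult_nonneg_nonneg[OF zero_le_power2] energy_density_parts_nonneg(1))
      ultimately show "c * (u i x)\<^sup>2 \<le> energy_density L u u x"
        unfolding energy_density_diag c_def mult.assoc by linarith
    qed (use jet_integrable_square[OF u2 i] energy_density_integrable[OF u2 u2] in auto)
    then have "c * (LINT x|lborel. (u i x)\<^sup>2) \<le> 2" using u(2) by (simp add: energy_def)
    then show ?thesis using c by (simp add: le_divide_eq mult.commute)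
  qed
  moreover have "2 / c > 0" using c by simp
  ultimately show ?thesis using that by blast
qed

text \<open>Cauchy--Schwarz for the nonnegative form \<open>energy L - buoyancy\<close>: almost minimizers are almost critical.\<close>

lemma almost_critical:
  assumes low: "\<And>v. jet 3 v \<Longrightarrow> buoyancy v v \<le> energy L v v" and u: "jet 3 u" and v: "jet 3 v"
  shows "(energy L u v - buoyancy u v)\<^sup>2 \<le> (energy L u u - buoyancy u u) * (energy L v v - buoyancy v v)"
proof (rule nonneg_quadratic_discriminant)
  have u2: "jet 2 u" and v2: "jet 2 v" using u v by (auto intro: jet_mono)
  show "0 \<le> energy L v v - buoyancy v v" using low[OF v] by simp
  fix t
  define w where "w = (\<lambda>i x. u i x + t * v i x)"
  have w: "jet 3 w" unfolding w_def by (intro jet_add jet_cmult u v)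
  have "energy L w w = (LINT x|lborel. energy_density L u u x + ((2 * t) * energy_density L u v x + t\<^sup>2 * energy_density L v v x))"
    unfolding energy_def w_def by (intro Bochner_Integration.integral_cong refl)
      (simp add: energy_density_def power2_eq_square algebra_simps)
  also have "\<dots> = energy L u u + (2 * t * energy L u v + t\<^sup>2 * energy L v v)"
    using energy_density_integrable[OF u2 u2] energy_density_integrable[OF u2 v2] energy_density_integrable[OF v2 v2]
    by (simp add: energy_def)
  finally have 1: "energy L w w = energy L u u + (2 * t * energy L u v + t\<^sup>2 * energy L v v)" .
  have "buoyancy w w = (LINT x|lborel. buoyancy_density u u x + ((2 * t) * buoyancy_density u v x + t\<^sup>2 * buoyancy_density v v x))"
    unfolding buoyancy_def w_def by (intro Bochner_Integration.integral_cong refl)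
      (simp add: buoyancy_density_def power2_eq_square algebra_simps)
  also have "\<dots> = buoyancy u u + (2 * t * buoyancy u v + t\<^sup>2 * buoyancy v v)"
    using buoyancy_density_integrable[OF u2 u2] buoyancy_density_integrable[OF u2 v2] buoyancy_density_integrable[OF v2 v2]
    by (simp add: buoyancy_def)
  finally show "0 \<le> (energy L u u - buoyancy u u) + 2 * t * (energy L u v - buoyancy u v) + t\<^sup>2 * (energy L v v - buoyancy v v)"
    using low[OF w] 1 by (simp add: algebra_simps)
qed

text \<open>With \<open>coeff1\<close> below, the equation takes the divergence form L mu f'''' -
  (\<open>coeff1\<close> f')' + \<open>coeff0\<close> f = 0.\<close>

definition coeff0 :: "real \<Rightarrow> real \<Rightarrow> real" where
  "coeff0 L x = L\<^sup>2 * k\<^sup>2 * \<rho> x + L * \<mu> * k ^ 4 - g * k\<^sup>2 * r x"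

definition coeff1 :: "real \<Rightarrow> real \<Rightarrow> real" where
  "coeff1 L x = L\<^sup>2 * \<rho> x + 2 * L * \<mu> * k\<^sup>2"

lemma continuous_coeffs: "continuous_on UNIV (coeff0 L)" "continuous_on UNIV (coeff1 L)"
  unfolding coeff0_def[abs_def] coeff1_def[abs_def] by (intro continuous_intros c\<rho> cr)+

text \<open>The first variation, with the leading term \<open>\<phi>'' v''\<close> integrated by parts to \<open>- \<phi>' v'''\<close>.\<close>

definition variation_density :: "real \<Rightarrow> (real \<Rightarrow> real) \<Rightarrow> (real \<Rightarrow> real) \<Rightarrow> (nat \<Rightarrow> real \<Rightarrow> real) \<Rightarrow> real \<Rightarrow> real" where
  "variation_density L f f1 v x = (coeff0 L x * f x) * v 0 x + ((coeff1 L x * f1 x) * v 1 x - (L * \<mu> * f1 x) * v 3 x)"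

lemma csc_variation_density_parts:
  assumes "jet 3 v" "continuous_on UNIV f" "continuous_on UNIV f1"
  shows "csc (\<lambda>x. (coeff0 L x * f x) * v 0 x)" "csc (\<lambda>x. (coeff1 L x * f1 x) * v 1 x)"
    "csc (\<lambda>x. (L * \<mu> * f1 x) * v 3 x)"
  using assms jet_csc[OF assms(1)]
  by (auto intro!: csc_mult continuous_on_mult continuous_coeffs continuous_on_const)

lemma csc_variation_density:
  assumes "jet 3 v" "continuous_on UNIV f" "continuous_on UNIV f1"
  shows "csc (variation_density L f f1 v)"
  unfolding variation_density_def[abs_def] using csc_variation_density_parts[OF assms] by (intro csc_add csc_diff)

text \<open>The two integrands differ by \<open>L * \<mu>\<close> times the derivative of
  \<open>u 1 x * v 2 x\<close>, which integrates to zero. The right side no longer contains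
  \<open>u 2\<close>, the derivative without a pointwise limit.\<close>

lemma first_variation:
  assumes u: "jet 3 u" and v: "jet 3 v"
  shows "energy L u v - buoyancy u v = (LINT x|lborel. variation_density L (u 0) (u 1) v x)"
proof -
  have u2: "jet 2 u" and v2: "jet 2 v" using u v by (auto intro: jet_mono)
  have du: "(u 1 has_real_derivative u 2 x) (at x)" for x
    using jet_DERIV[OF u, of 1] by (simp add: numeral_2_eq_2)
  have dv: "(v 2 has_real_derivative v 3 x) (at x)" for x
    using jet_DERIV[OF v, of 2] by (simp add: numeral_3_eq_3 numeral_2_eq_2)
  have c: "csc (u 1)" "csc (u 2)" "csc (v 2)" "csc (v 3)" "csc (u 0)"
    using jet_csc[OF u] jet_csc[OF v] by auto
  have ibp: "(LINT x|lborel. u 1 x * v 3 x) = - (LINT x|lborel. u 2 x * v 2 x)"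
    by (rule integral_by_parts_csc[OF du csc_continuous[OF c(2)] dv c(3,4)])
  have i: "integrable lborel (\<lambda>x. u 1 x * v 3 x)" "integrable lborel (\<lambda>x. u 2 x * v 2 x)"
    by (intro csc_integrable csc_mult csc_continuous c)+
  have iw: "integrable lborel (variation_density L (u 0) (u 1) v)"
    by (intro csc_integrable csc_variation_density v csc_continuous c)
  have "energy L u v - buoyancy u v = (LINT x|lborel. energy_density L u v x - buoyancy_density u v x)"
    using energy_density_integrable[OF u2 v2] buoyancy_density_integrable[OF u2 v2] by (simp add: energy_def buoyancy_def)
  also have "\<dots> = (LINT x|lborel. variation_density L (u 0) (u 1) v x
      + (L * \<mu>) * (u 1 x * v 3 x + u 2 x * v 2 x))"
    by (intro Bochner_Integration.integral_cong refl)
      (simp add: energy_density_def buoyancy_density_def variation_density_def coeff0_def coeff1_def algebra_simps)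
  also have "\<dots> = (LINT x|lborel. variation_density L (u 0) (u 1) v x)"
    using i iw ibp by simp
  finally show ?thesis .
qed

section \<open>Existence of a weak solution\<close>

definition critical_profile :: "real \<Rightarrow> (real \<Rightarrow> real) \<Rightarrow> (real \<Rightarrow> real) \<Rightarrow> bool" where
  "critical_profile L f f1 \<longleftrightarrow> (\<forall>x. (f has_real_derivative f1 x) (at x)) \<and> continuous_on UNIV f1 \<and>
     (\<exists>x. f x \<noteq> 0) \<and> (\<forall>v. jet 3 v \<longrightarrow> (LINT x|lborel. variation_density L f f1 v x) = 0)"

text \<open>Keeps what the square integrability of the limit and its first two derivatives requires:
  L^2 bounds up to order 2, but convergence only of orders 0 and 1.\<close>

definition approximates ::
  "(nat \<Rightarrow> nat \<Rightarrow> real \<Rightarrow> real) \<Rightarrow> real \<Rightarrow> real \<Rightarrow> (real \<Rightarrow> real) \<Rightarrow> (real \<Rightarrow> real) \<Rightarrow> bool" where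
  "approximates u M B f f1 \<longleftrightarrow> (\<forall>n. jet 3 (u n)) \<and>
     (\<forall>n. \<forall>i\<le>2. (LINT x|lborel. (u n i x)\<^sup>2) \<le> M) \<and> (\<forall>n x. \<bar>u n 1 x\<bar> \<le> B) \<and>
     (\<forall>x. (\<lambda>n. u n 0 x) \<longlonglongrightarrow> f x) \<and> (\<forall>x. (\<lambda>n. u n 1 x) \<longlonglongrightarrow> f1 x)"

lemma critical_profile_exists:
  obtains L f f1 u M B where "L > 0" "L\<^sup>2 \<le> g * K" "critical_profile L f f1" "approximates u M B f f1"
proof -
  obtain L where L: "L > 0" "L\<^sup>2 \<le> g * K" "\<And>v. jet 3 v \<Longrightarrow> buoyancy v v \<le> energy L v v"
    "\<And>e. e > 0 \<Longrightarrow> \<exists>u. jet 3 u \<and> buoyancy u u = 1 \<and> energy L u u \<le> 1 + e"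
    using critical_value_exists by blast
  obtain M where M: "M > 0"
    "\<And>u i. jet 3 u \<Longrightarrow> energy L u u \<le> 2 \<Longrightarrow> i \<le> 2 \<Longrightarrow> (LINT x|lborel. (u i x)\<^sup>2) \<le> M"
    using energy_controls_derivatives[OF L(1)] by blast
  have "\<forall>n. \<exists>u. jet 3 u \<and> buoyancy u u = 1 \<and> energy L u u \<le> 1 + inverse (real (Suc n))"
    using L(4) by simp
  then obtain w where w: "\<And>n. jet 3 (w n)" "\<And>n. buoyancy (w n) (w n) = 1"
    "\<And>n. energy L (w n) (w n) \<le> 1 + inverse (real (Suc n))" by metis
  have "inverse (real (Suc n)) \<le> 1" for n by (simp add: inverse_eq_divide)
  then have w2: "energy L (w n) (w n) \<le> 2" for n using w(3)[of n] by (smt (verit))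
  have sq: "(LINT x|lborel. (w n i x)\<^sup>2) \<le> M" if "i \<le> 2" for n i
    by (rule M(2)[OF w(1) w2 that])
  have dw: "(w n 0 has_real_derivative w n 1 x) (at x)" "(w n 1 has_real_derivative w n 2 x) (at x)" for n x
    using jet_DERIV[OF w(1)[of n], of 0] jet_DERIV[OF w(1)[of n], of 1] by (simp_all add: numeral_2_eq_2)
  have cw: "csc (w n 0)" "csc (w n 1)" "csc (w n 2)" for n using jet_csc[OF w(1)] by auto
  \<comment> \<open>The sup bound adds two L^2 integrals, each at most \<open>M\<close>.\<close>
  define B where "B = sqrt (2 * M)"
  have B: "\<bar>w n 0 x\<bar> \<le> B" "\<bar>w n 1 x\<bar> \<le> B" for n x
  proof -
    have "(w n 0 x)\<^sup>2 \<le> 2 * M" "(w n 1 x)\<^sup>2 \<le> 2 * M"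
      using csc_sup_bound[OF cw(1,2) dw(1), of n x] csc_sup_bound[OF cw(2,3) dw(2), of n x]
        sq[of 0 n] sq[of 1 n] sq[of 2 n] by auto
    then show "\<bar>w n 0 x\<bar> \<le> B" "\<bar>w n 1 x\<bar> \<le> B"
      unfolding B_def by (auto intro!: real_le_rsqrt)
  qed
  have B0: "B \<ge> 0" using B(1)[of 0 0] by linarith
  have hl: "(w n 0 x - w n 0 y)\<^sup>2 \<le> M * \<bar>x - y\<bar>" "(w n 1 x - w n 1 y)\<^sup>2 \<le> M * \<bar>x - y\<bar>" for n x y
    using csc_holder_bound[OF cw(2) dw(1), of n x y] csc_holder_bound[OF cw(3) dw(2), of n x y]
      mult_right_mono[OF sq[of 1 n], of "\<bar>x - y\<bar>"] mult_right_mono[OF sq[of 2 n], of "\<bar>x - y\<bar>"]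
    by auto
  obtain \<sigma> f where \<sigma>: "strict_mono (\<sigma> :: nat \<Rightarrow> nat)" "\<And>x. (\<lambda>n. w (\<sigma> n) 0 x) \<longlonglongrightarrow> f x"
    "continuous_on UNIV f"
    using holder_subsequence[of "\<lambda>n. w n 0", OF B(1) hl(1)] by blast
  obtain \<tau> f1 where \<tau>: "strict_mono (\<tau> :: nat \<Rightarrow> nat)" "\<And>x. (\<lambda>n. w (\<sigma> (\<tau> n)) 1 x) \<longlonglongrightarrow> f1 x"
    "continuous_on UNIV f1"
    using holder_subsequence[of "\<lambda>n. w (\<sigma> n) 1", OF B(2) hl(2)] by blast
  define u where "u = (\<lambda>n. w (\<sigma> (\<tau> n)))"
  have lim: "(\<lambda>n. u n 0 x) \<longlonglongrightarrow> f x" "(\<lambda>n. u n 1 x) \<longlonglongrightarrow> f1 x" for x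
    using LIMSEQ_subseq_LIMSEQ[OF \<sigma>(2) \<tau>(1), of x] \<tau>(2)[of x] by (auto simp: u_def o_def)
  have u: "jet 3 (u n)" "buoyancy (u n) (u n) = 1" for n using w by (auto simp: u_def)
  have uB: "\<bar>u n 0 x\<bar> \<le> B" "\<bar>u n 1 x\<bar> \<le> B" for n x using B by (auto simp: u_def)
  have du: "(u n 0 has_real_derivative u n 1 x) (at x)" for n x using dw by (simp add: u_def)
  have cu: "continuous_on UNIV (u n 0)" "continuous_on UNIV (u n 1)" for n
    using cw csc_continuous by (auto simp: u_def)
  have Elim: "(\<lambda>n. energy L (u n) (u n) - 1) \<longlonglongrightarrow> 0"
  proof -
    have "(\<lambda>n. energy L (w n) (w n) - 1) \<longlonglongrightarrow> 0"
    proof (rule tendsto_sandwich[OF _ _ tendsto_const LIMSEQ_inverse_real_of_nat])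
      show "\<forall>\<^sub>F n in sequentially. 0 \<le> energy L (w n) (w n) - 1"
        using L(3)[OF w(1)] w(2) by (intro always_eventually allI) (metis diff_ge_0_iff_ge)
      show "\<forall>\<^sub>F n in sequentially. energy L (w n) (w n) - 1 \<le> inverse (real (Suc n))"
        using w(3) by (intro always_eventually allI) (metis add.commute diff_le_eq)
    qed
    from LIMSEQ_subseq_LIMSEQ[OF this strict_mono_o[OF \<sigma>(1) \<tau>(1)]]
    show ?thesis by (simp add: u_def o_def)
  qed
  \<comment> \<open>The fundamental theorem of calculus for \<open>u n\<close> on
    \<open>{x..y}\<close> passes to the limit by domination with \<open>B\<close>, so
    \<open>f\<close> differs from a primitive of the continuous \<open>f1\<close> by a
    constant.\<close>
  have df: "(f has_real_derivative f1 x) (at x)" for x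
  proof -
    obtain G where G: "\<And>x. (G has_real_derivative f1 x) (at x)"
      using antiderivative_exists[OF \<tau>(3)] by blast
    have inc: "f y - f x = G y - G x" if xy: "x \<le> y" for x y
    proof -
      have "(\<lambda>n. LINT t|lborel. u n 1 t * indicator {x..y} t) \<longlonglongrightarrow> (LINT t|lborel. f1 t * indicator {x..y} t)"
      proof (rule integral_dominated_convergence[where w = "\<lambda>t. B * indicator {x..y} t"])
        show "(\<lambda>t. f1 t * indicator {x..y} t) \<in> borel_measurable lborel"
          "(\<lambda>t. u n 1 t * indicator {x..y} t) \<in> borel_measurable lborel" for n
          using continuous_measurable[OF \<tau>(3)] continuous_measurable[OF cu(2)[of n]]
          by (auto intro!: borel_measurable_times)
        show "AE t in lborel. (\<lambda>n. u n 1 t * indicator {x..y} t) \<longlonglongrightarrow> f1 t * indicator {x..y} t"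
          by (intro always_eventually allI tendsto_intros lim)
        show "AE t in lborel. norm (u n 1 t * indicator {x..y} t) \<le> B * indicator {x..y} t" for n
          using uB(2)[of n] by (intro always_eventually allI) (auto simp: indicator_def abs_mult)
        show "integrable lborel (\<lambda>t. B * indicator {x..y} t)"
          by (intro integrable_mult_right integrable_real_indicator) (auto simp: emeasure_lborel_Icc_eq)
      qed
      moreover have "(LINT t|lborel. u n 1 t * indicator {x..y} t) = u n 0 y - u n 0 x" for n
        by (rule integral_indicator_DERIV(2)[OF xy du cu(2)])
      moreover have "(LINT t|lborel. f1 t * indicator {x..y} t) = G y - G x"
        by (rule integral_indicator_DERIV(2)[OF xy G \<tau>(3)])
      ultimately have "(\<lambda>n. u n 0 y - u n 0 x) \<longlonglongrightarrow> G y - G x" by simp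
      moreover have "(\<lambda>n. u n 0 y - u n 0 x) \<longlonglongrightarrow> f y - f x" by (intro tendsto_intros lim)
      ultimately show ?thesis using LIMSEQ_unique by blast
    qed
    have "f y = G y + (f 0 - G 0)" for y
      using inc[of 0 y] inc[of y 0] by (cases "0 \<le> y") auto
    then have "f = (\<lambda>y. G y + (f 0 - G 0))" by blast
    moreover have "((\<lambda>y. G y + (f 0 - G 0)) has_real_derivative f1 x) (at x)"
      by (auto intro!: derivative_eq_intros G)
    ultimately show ?thesis by metis
  qed
  \<comment> \<open>On the unbounded line the sequence could escape to infinity. The integrable
    majorant, a multiple of \<open>r\<close>, excludes this: a vanishing limit would force the
    normalized buoyancy 1 to tend to 0.\<close>
  have nz: "\<exists>x. f x \<noteq> 0"
  proof (rule ccontr)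
    assume "\<not> ?thesis"
    then have f0: "f x = 0" for x by blast
    have "(\<lambda>n. LINT x|lborel. buoyancy_density (u n) (u n) x) \<longlonglongrightarrow> (LINT x|(lborel :: real measure). 0)"
    proof (rule integral_dominated_convergence[where w = "\<lambda>x. (g * k\<^sup>2 * B\<^sup>2) * r x"])
      show "buoyancy_density (u n) (u n) \<in> borel_measurable lborel" for n
        using u(1)[of n] by (intro continuous_measurable csc_continuous csc_buoyancy_density) (auto intro: jet_mono)
      show "integrable lborel (\<lambda>x. (g * k\<^sup>2 * B\<^sup>2) * r x)" using r(4) by simp
      show "AE x in lborel. (\<lambda>n. buoyancy_density (u n) (u n) x) \<longlonglongrightarrow> 0"
      proof (intro always_eventually allI)
        fix x
        have "(\<lambda>n. (g * k\<^sup>2) * (r x * (u n 0 x)\<^sup>2)) \<longlonglongrightarrow> (g * k\<^sup>2) * (r x * (f x)\<^sup>2)"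
          by (intro tendsto_intros lim)
        then show "(\<lambda>n. buoyancy_density (u n) (u n) x) \<longlonglongrightarrow> 0" by (simp add: buoyancy_density_diag f0)
      qed
      show "AE x in lborel. norm (buoyancy_density (u n) (u n) x) \<le> (g * k\<^sup>2 * B\<^sup>2) * r x" for n
      proof (intro always_eventually allI)
        fix x
        have "(u n 0 x)\<^sup>2 \<le> B\<^sup>2" using uB(1)[of n x] B0 by (simp add: abs_le_square_iff[symmetric])
        then have "(g * k\<^sup>2 * r x) * (u n 0 x)\<^sup>2 \<le> (g * k\<^sup>2 * r x) * B\<^sup>2"
          using pos r(1)[of x] by (intro mult_left_mono) auto
        then show "norm (buoyancy_density (u n) (u n) x) \<le> (g * k\<^sup>2 * B\<^sup>2) * r x"
          using buoyancy_density_nonneg[of "u n" x] by (simp add: buoyancy_density_diag mult_ac)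
      qed
    qed simp
    then have "(\<lambda>n. 1::real) \<longlonglongrightarrow> 0" using u(2) by (simp add: buoyancy_def)
    then show False by (simp add: LIMSEQ_const_iff)
  qed
  have weak: "(LINT x|lborel. variation_density L f f1 v x) = 0" if v: "jet 3 v" for v
  proof -
    have cv: "csc (v 0)" "csc (v 1)" "csc (v 3)" using jet_csc[OF v] by auto
    define a1 a2 a3 where "a1 = (\<lambda>x. \<bar>coeff0 L x * v 0 x\<bar>)" and "a2 = (\<lambda>x. \<bar>coeff1 L x * v 1 x\<bar>)"
      and "a3 = (\<lambda>x. \<bar>(L * \<mu>) * v 3 x\<bar>)"
    have ca: "csc a1" "csc a2" "csc a3" unfolding a1_def a2_def a3_def
      by (rule csc_abs[OF csc_mult[OF continuous_coeffs(1) cv(1)]] csc_abs[OF csc_mult[OF continuous_coeffs(2) cv(2)]]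
          csc_abs[OF csc_cmult[OF cv(3)]])+
    have "(\<lambda>n. LINT x|lborel. variation_density L (u n 0) (u n 1) v x) \<longlonglongrightarrow> (LINT x|lborel. variation_density L f f1 v x)"
    proof (rule integral_dominated_convergence[where w = "\<lambda>x. B * (a1 x + (a2 x + a3 x))"])
      show "variation_density L f f1 v \<in> borel_measurable lborel" "variation_density L (u n 0) (u n 1) v \<in> borel_measurable lborel" for n
        by (intro continuous_measurable csc_continuous csc_variation_density v \<sigma> \<tau> cu)+
      show "integrable lborel (\<lambda>x. B * (a1 x + (a2 x + a3 x)))"
        by (intro csc_integrable csc_cmult csc_add ca)
      show "AE x in lborel. (\<lambda>n. variation_density L (u n 0) (u n 1) v x) \<longlonglongrightarrow> variation_density L f f1 v x"
        unfolding variation_density_def by (intro always_eventually allI tendsto_intros lim)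
      show "AE x in lborel. norm (variation_density L (u n 0) (u n 1) v x) \<le> B * (a1 x + (a2 x + a3 x))" for n
      proof (intro always_eventually allI)
        fix x
        have "\<bar>(coeff0 L x * u n 0 x) * v 0 x\<bar> \<le> B * a1 x"
          using mult_right_mono[OF uB(1)[of n x], of "a1 x"] by (simp add: a1_def abs_mult mult_ac)
        moreover have "\<bar>(coeff1 L x * u n 1 x) * v 1 x\<bar> \<le> B * a2 x"
          using mult_right_mono[OF uB(2)[of n x], of "a2 x"] by (simp add: a2_def abs_mult mult_ac)
        moreover have "\<bar>(L * \<mu> * u n 1 x) * v 3 x\<bar> \<le> B * a3 x"
          using mult_right_mono[OF uB(2)[of n x], of "a3 x"] by (simp add: a3_def abs_mult mult_ac)
        ultimately show "norm (variation_density L (u n 0) (u n 1) v x) \<le> B * (a1 x + (a2 x + a3 x))"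
          unfolding variation_density_def real_norm_def distrib_left by linarith
      qed
    qed
    then have l1: "(\<lambda>n. energy L (u n) v - buoyancy (u n) v) \<longlonglongrightarrow> (LINT x|lborel. variation_density L f f1 v x)"
      using first_variation[OF u(1) v] by simp
    \<comment> \<open>The bound is the defect of \<open>u n\<close>, which tends to 0, times a
      factor depending only on \<open>v\<close>.\<close>
    have "(\<lambda>n. (energy L (u n) v - buoyancy (u n) v)\<^sup>2) \<longlonglongrightarrow> 0"
    proof (rule tendsto_sandwich[OF _ _ tendsto_const])
      show "\<forall>\<^sub>F n in sequentially. 0 \<le> (energy L (u n) v - buoyancy (u n) v)\<^sup>2" by simp
      show "\<forall>\<^sub>F n in sequentially. (energy L (u n) v - buoyancy (u n) v)\<^sup>2 \<le> (energy L (u n) (u n) - 1) * (energy L v v - buoyancy v v)"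
        using almost_critical[OF L(3) u(1) v] u(2) by (intro always_eventually allI) simp
      show "(\<lambda>n. (energy L (u n) (u n) - 1) * (energy L v v - buoyancy v v)) \<longlonglongrightarrow> 0"
        using tendsto_mult_left_zero[OF Elim] by blast
    qed
    moreover have "(\<lambda>n. (energy L (u n) v - buoyancy (u n) v)\<^sup>2) \<longlonglongrightarrow> (LINT x|lborel. variation_density L f f1 v x)\<^sup>2"
      by (intro tendsto_intros l1)
    ultimately have "(LINT x|lborel. variation_density L f f1 v x)\<^sup>2 = 0" using LIMSEQ_unique by blast
    then show ?thesis by simp
  qed
  have "(LINT x|lborel. (u n i x)\<^sup>2) \<le> M" if "i \<le> 2" for n i
    using sq[OF that] by (simp add: u_def)
  then have "approximates u M B f f1" unfolding approximates_def using u(1) uB(2) lim by blast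
  moreover have "critical_profile L f f1" unfolding critical_profile_def using df \<tau>(3) nz weak by blast
  ultimately show ?thesis using that[OF L(1,2)] by blast
qed

text \<open>The successive primitives \<open>F\<close>, \<open>H1\<close>, \<open>H2\<close> move
  all lower-order terms onto v''', so the weak equation says that \<open>H2 - L * \<mu> * f1\<close>
  annihilates every v''' and is a quadratic polynomial. As \<open>H2\<close> is twice
  differentiable, so is \<open>f1\<close>.\<close>

lemma weak_solution_regular:
  assumes L: "L > 0" and df: "\<And>x. (f has_real_derivative f1 x) (at x)" and cf1: "continuous_on UNIV f1"
    and weak: "\<And>v. jet 3 v \<Longrightarrow> (LINT x|lborel. variation_density L f f1 v x) = 0"
  obtains f2 f3 f4 where "\<And>x. (f1 has_real_derivative f2 x) (at x)" "\<And>x. (f2 has_real_derivative f3 x) (at x)"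
    "\<And>x. (f3 has_real_derivative f4 x) (at x)"
    "\<And>x. L * \<mu> * f4 x = L\<^sup>2 * r x * f1 x + coeff1 L x * f2 x - coeff0 L x * f x"
proof -
  have cf: "continuous_on UNIV f" using df by (rule continuous_on_DERIV)
  obtain F where F: "\<And>x. (F has_real_derivative coeff0 L x * f x) (at x)"
    using antiderivative_exists[OF continuous_on_mult[OF continuous_coeffs(1) cf]] by blast
  have cF: "continuous_on UNIV F" using F by (rule continuous_on_DERIV)
  define H where "H = (\<lambda>x. coeff1 L x * f1 x - F x)"
  have cH: "continuous_on UNIV H" unfolding H_def by (intro continuous_intros continuous_coeffs cf1 cF)
  obtain H1 where H1: "\<And>x. (H1 has_real_derivative H x) (at x)"
    using antiderivative_exists[OF cH] by blast
  have cH1: "continuous_on UNIV H1" using H1 by (rule continuous_on_DERIV)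
  obtain H2 where H2: "\<And>x. (H2 has_real_derivative H1 x) (at x)"
    using antiderivative_exists[OF cH1] by blast
  have cH2: "continuous_on UNIV H2" using H2 by (rule continuous_on_DERIV)
  have "(LINT x|lborel. (H2 x - L * \<mu> * f1 x) * v 3 x) = 0" if v: "jet 3 v" for v
  proof -
    have cv: "csc (v 0)" "csc (v 1)" "csc (v 3)" using jet_csc[OF v] by auto
    have p: "csc (\<lambda>x. (coeff0 L x * f x) * v 0 x)" "csc (\<lambda>x. (coeff1 L x * f1 x) * v 1 x)"
      "csc (\<lambda>x. (L * \<mu> * f1 x) * v 3 x)" by (rule csc_variation_density_parts[OF v cf cf1])+
    have "0 = (LINT x|lborel. (coeff0 L x * f x) * v 0 x) + ((LINT x|lborel. (coeff1 L x * f1 x) * v 1 x)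
        - (LINT x|lborel. (L * \<mu> * f1 x) * v 3 x))"
      using weak[OF v] csc_integrable[OF p(1)] csc_integrable[OF p(2)] csc_integrable[OF p(3)]
      unfolding variation_density_def by simp
    moreover have "(LINT x|lborel. F x * v (Suc 0) x) = - (LINT x|lborel. (coeff0 L x * f x) * v 0 x)"
      by (rule jet_by_parts[OF F _ v]) (auto intro: continuous_on_mult continuous_coeffs cf)
    moreover have "(LINT x|lborel. H1 x * v (Suc 1) x) = - (LINT x|lborel. H x * v 1 x)"
      by (rule jet_by_parts[OF H1 cH v]) simp
    moreover have "(LINT x|lborel. H2 x * v (Suc 2) x) = - (LINT x|lborel. H1 x * v 2 x)"
      by (rule jet_by_parts[OF H2 cH1 v]) simp
    moreover have "(LINT x|lborel. H x * v 1 x)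
        = (LINT x|lborel. (coeff1 L x * f1 x) * v 1 x) - (LINT x|lborel. F x * v 1 x)"
      unfolding H_def by (rule integral_minus_csc[OF _ cF cv(2)]) (intro continuous_on_mult continuous_coeffs cf1)
    moreover have "(LINT x|lborel. (H2 x - L * \<mu> * f1 x) * v 3 x)
        = (LINT x|lborel. H2 x * v 3 x) - (LINT x|lborel. (L * \<mu> * f1 x) * v 3 x)"
      by (rule integral_minus_csc[OF cH2 _ cv(3)]) (intro continuous_intros cf1)
    ultimately show ?thesis by (simp add: numeral_2_eq_2 numeral_3_eq_3)
  qed
  moreover have "continuous_on UNIV (\<lambda>x. H2 x - L * \<mu> * f1 x)" by (intro continuous_intros cH2 cf1)
  ultimately obtain a0 b0 c0 where abc: "\<And>x. H2 x - L * \<mu> * f1 x = a0 + b0 * x + c0 * x\<^sup>2"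
    using du_Bois_Reymond_3[of "\<lambda>x. H2 x - L * \<mu> * f1 x"] by blast
  have Lm: "L * \<mu> \<noteq> 0" using L pos by simp
  define f2 where "f2 = (\<lambda>x. (H1 x - b0 - 2 * c0 * x) / (L * \<mu>))"
  define f3 where "f3 = (\<lambda>x. (H x - 2 * c0) / (L * \<mu>))"
  define f4 where "f4 = (\<lambda>x. (L\<^sup>2 * r x * f1 x + coeff1 L x * f2 x - coeff0 L x * f x) / (L * \<mu>))"
  have "f1 = (\<lambda>x. (H2 x - a0 - b0 * x - c0 * x\<^sup>2) / (L * \<mu>))"
  proof
    fix x
    show "f1 x = (H2 x - a0 - b0 * x - c0 * x\<^sup>2) / (L * \<mu>)"
      using abc[of x] Lm by (simp add: eq_divide_eq algebra_simps)
  qed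
  moreover have "((\<lambda>x. (H2 x - a0 - b0 * x - c0 * x\<^sup>2) / (L * \<mu>)) has_real_derivative f2 x) (at x)" for x
    unfolding f2_def by (rule DERIV_cdivide) (auto intro!: derivative_eq_intros H2)
  ultimately have d1: "(f1 has_real_derivative f2 x) (at x)" for x by simp
  have d2: "(f2 has_real_derivative f3 x) (at x)" for x
    unfolding f2_def f3_def by (rule DERIV_cdivide) (auto intro!: derivative_eq_intros H1)
  \<comment> \<open>The bootstrap: \<open>H\<close>, hence \<open>f3\<close>, involves only
    \<open>coeff1 L\<close>, \<open>f1\<close> and \<open>F\<close>, all of which are now known to
    be differentiable.\<close>
  have "(coeff1 L has_real_derivative L\<^sup>2 * r x) (at x)" for x
    unfolding coeff1_def[abs_def] by (auto intro!: derivative_eq_intros d\<rho>)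
  then have d3: "(f3 has_real_derivative f4 x) (at x)" for x
    unfolding f3_def f4_def H_def by (intro DERIV_cdivide) (auto intro!: derivative_eq_intros d1 F)
  have "L * \<mu> * f4 x = L\<^sup>2 * r x * f1 x + coeff1 L x * f2 x - coeff0 L x * f x" for x
    using Lm by (simp add: f4_def)
  from that[OF d1 d2 d3 this] show ?thesis .
qed

section \<open>Square integrability of all derivatives and the eigenfunction in H^4\<close>

lemma coeffs_bounded: obtains c where "\<And>x. \<bar>coeff0 L x\<bar> \<le> c" "\<And>x. \<bar>coeff1 L x\<bar> \<le> c" "\<And>x. \<bar>L\<^sup>2 * r x\<bar> \<le> c"
proof -
  have \<rho>b: "\<bar>\<rho> x\<bar> \<le> b" and rb: "\<bar>r x\<bar> \<le> m" for x
    using \<rho>_pos[of x] \<rho>(2)[of x] r(1)[of x] r(2)[of x] by auto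
  define c1 c2 c3 where "c1 = L\<^sup>2 * k\<^sup>2 * b + \<bar>L * \<mu> * k ^ 4\<bar> + \<bar>g * k\<^sup>2\<bar> * m"
    and "c2 = L\<^sup>2 * b + \<bar>2 * L * \<mu> * k\<^sup>2\<bar>" and "c3 = L\<^sup>2 * m"
  have "\<bar>coeff0 L x\<bar> \<le> c1" for x
  proof -
    have "\<bar>L\<^sup>2 * k\<^sup>2 * \<rho> x\<bar> \<le> L\<^sup>2 * k\<^sup>2 * b" using \<rho>b[of x] by (simp add: abs_mult mult_left_mono)
    moreover have "\<bar>g * k\<^sup>2 * r x\<bar> \<le> \<bar>g * k\<^sup>2\<bar> * m"
      unfolding abs_mult[of "g * k\<^sup>2"] by (intro mult_left_mono rb) simp
    ultimately show ?thesis unfolding coeff0_def c1_def by linarith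
  qed
  moreover have "\<bar>coeff1 L x\<bar> \<le> c2" for x
  proof -
    have "\<bar>L\<^sup>2 * \<rho> x\<bar> \<le> L\<^sup>2 * b" using \<rho>b[of x] by (simp add: abs_mult mult_left_mono)
    then show ?thesis unfolding coeff1_def c2_def by linarith
  qed
  moreover have "\<bar>L\<^sup>2 * r x\<bar> \<le> c3" for x
    using rb[of x] by (simp add: c3_def abs_mult mult_left_mono)
  ultimately show ?thesis by (intro that[of "max c1 (max c2 c3)"]) (simp_all add: le_max_iff_disj)
qed

lemma eigenvalue_exists:
  obtains L \<phi> where "L > 0" "L\<^sup>2 \<le> g * K" "\<phi> \<in> sobolev_H 4" "\<not> (AE x in lborel. \<phi> x = 0)"
    "\<exists>\<phi>1 \<phi>2 \<phi>4 d. weak_deriv 1 \<phi> \<phi>1 \<and> weak_deriv 2 \<phi> \<phi>2 \<and> weak_deriv 4 \<phi> \<phi>4 \<and>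
      weak_deriv 1 (\<lambda>x. \<rho> x * \<phi>1 x) d \<and>
      (\<forall>x. - (L\<^sup>2) * (\<rho> x * k\<^sup>2 * \<phi> x - d x) =
        L * \<mu> * (\<phi>4 x - 2 * k\<^sup>2 * \<phi>2 x + k ^ 4 * \<phi> x) - g * k\<^sup>2 * r x * \<phi> x)"
proof -
  obtain L f f1 u M B where L: "L > 0" "L\<^sup>2 \<le> g * K"
    and crit: "critical_profile L f f1" and app: "approximates u M B f f1"
    by (rule critical_profile_exists)
  have df: "\<And>x. (f has_real_derivative f1 x) (at x)" and cf1: "continuous_on UNIV f1"
    and nz: "\<exists>x. f x \<noteq> 0"
    and weak: "\<And>v. jet 3 v \<Longrightarrow> (LINT x|lborel. variation_density L f f1 v x) = 0"
    using crit unfolding critical_profile_def by blast+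
  have u: "\<And>n. jet 3 (u n)" "\<And>n i. i \<le> 2 \<Longrightarrow> (LINT x|lborel. (u n i x)\<^sup>2) \<le> M"
      "\<And>n x. \<bar>u n 1 x\<bar> \<le> B"
    and lim: "\<And>x. (\<lambda>n. u n 0 x) \<longlonglongrightarrow> f x" "\<And>x. (\<lambda>n. u n 1 x) \<longlonglongrightarrow> f1 x"
    using app unfolding approximates_def by blast+
  obtain f2 f3 f4 where d: "\<And>x. (f1 has_real_derivative f2 x) (at x)" "\<And>x. (f2 has_real_derivative f3 x) (at x)"
      "\<And>x. (f3 has_real_derivative f4 x) (at x)"
    and eq: "\<And>x. L * \<mu> * f4 x = L\<^sup>2 * r x * f1 x + coeff1 L x * f2 x - coeff0 L x * f x"
    using weak_solution_regular[OF L(1) df cf1 weak] by blast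
  have c: "continuous_on UNIV f" "continuous_on UNIV f2" "continuous_on UNIV f3"
    using df d continuous_on_DERIV by blast+
  have Lm: "L * \<mu> > 0" using L pos by simp
  have "f4 = (\<lambda>x. (L\<^sup>2 * r x * f1 x + coeff1 L x * f2 x - coeff0 L x * f x) / (L * \<mu>))"
    using eq Lm by (auto simp: fun_eq_iff eq_divide_eq mult_ac)
  then have c4: "continuous_on UNIV f4"
    using Lm by (auto intro!: continuous_intros c cf1 cr continuous_coeffs)
  have i0: "integrable lborel (\<lambda>x. (f x)\<^sup>2)"
    by (rule fatou_integrable[where s = "\<lambda>n x. (u n 0 x)\<^sup>2" and M = M])
      (auto intro!: u(2) tendsto_power lim jet_integrable_square[OF u(1)]
        borel_measurable_continuous_onI continuous_on_power c(1))
  have i1: "integrable lborel (\<lambda>x. (f1 x)\<^sup>2)"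
    by (rule fatou_integrable[where s = "\<lambda>n x. (u n 1 x)\<^sup>2" and M = M])
      (use u(2) lim(2) in \<open>auto intro!: tendsto_power jet_integrable_square[OF u(1)]
        borel_measurable_continuous_onI continuous_on_power cf1\<close>)
  have i2: "integrable lborel (\<lambda>x. (f2 x)\<^sup>2)"
  proof (rule limit_derivative_square_integrable[OF _ _ u(3) _ lim(2) d(1) d(2) c(3)])
    show "(u n 1 has_real_derivative u n 2 x) (at x)" for n x
      using jet_DERIV[OF u(1), of 1] by (simp add: numeral_2_eq_2)
    show "csc (u n 2)" for n using jet_csc[OF u(1)] by simp
    show "(LINT x|lborel. (u n 2 x)\<^sup>2) \<le> M" for n by (rule u(2)) simp
  qed
  have i4: "integrable lborel (\<lambda>x. (f4 x)\<^sup>2)"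
  proof -
    obtain c0 where c0: "\<And>x. \<bar>coeff0 L x\<bar> \<le> c0" "\<And>x. \<bar>coeff1 L x\<bar> \<le> c0" "\<And>x. \<bar>L\<^sup>2 * r x\<bar> \<le> c0"
      using coeffs_bounded by blast
    have "integrable lborel (\<lambda>x. (L * \<mu> * f4 x)\<^sup>2)"
    proof (rule integrable_square_bounded_combination[OF _ _ _ _ _ i0 i1 i2])
      show "continuous_on UNIV (\<lambda>x. L * \<mu> * f4 x)" by (intro continuous_intros c4)
      show "L * \<mu> * f4 x = (- coeff0 L x) * f x + (L\<^sup>2 * r x) * f1 x + coeff1 L x * f2 x" for x
        using eq[of x] by simp
      show "\<bar>- coeff0 L x\<bar> \<le> c0" for x using c0(1) by simp
    qed (use c0 in auto)
    then have "integrable lborel (\<lambda>x. (L * \<mu>)\<^sup>2 * (f4 x)\<^sup>2)" by (simp only: power_mult_distrib)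
    then show ?thesis using Lm by auto
  qed
  \<comment> \<open>Interpolated between f'' and f''''.\<close>
  have i3: "integrable lborel (\<lambda>x. (f3 x)\<^sup>2)"
    by (rule interpolation_integrable[OF d(2) d(3) c4 i2 i4])
  define w where "w = (\<lambda>i::nat. [f, f1, f2, f3, f4] ! i)"
  have wi: "w 0 = f" "w 1 = f1" "w 2 = f2" "w 3 = f3" "w 4 = f4" by (auto simp: w_def)
  have less4: "i = 0 \<or> i = 1 \<or> i = 2 \<or> i = 3" if "i < 4" for i :: nat using that by linarith
  have dw: "(w i has_real_derivative w (Suc i) x) (at x)" if "i < 4" for i x
    using less4[OF that] df d by (auto simp: w_def)
  have cw: "continuous_on UNIV (w i)" "integrable lborel (\<lambda>x. (w i x)\<^sup>2)" if "i \<le> 4" for i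
  proof -
    have "i = 0 \<or> i = 1 \<or> i = 2 \<or> i = 3 \<or> i = 4" using that by linarith
    then show "continuous_on UNIV (w i)" and "integrable lborel (\<lambda>x. (w i x)\<^sup>2)"
      by (elim disjE; simp add: w_def c cf1 c4 i0 i1 i2 i3 i4)+
  qed
  have wd: "weak_deriv j f (w j)" if "j \<le> 4" for j
    using weak_deriv_classical[of j w] dw cw that by (simp add: wi(1))
  have H4: "f \<in> sobolev_H 4"
    unfolding sobolev_H_def
  proof (intro CollectI conjI allI impI)
    show "square_integrable f" using square_integrable_continuous[OF c(1) i0] .
    fix j :: nat assume "j \<le> 4"
    then show "\<exists>h. square_integrable h \<and> weak_deriv j f h"
      using wd[of j] square_integrable_continuous[OF cw] by blast
  qed
  have nAE: "\<not> (AE x in lborel. f x = 0)"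
    using nz continuous_AE_zero[OF c(1)] by blast
  define dd where "dd = (\<lambda>x. r x * f1 x + \<rho> x * f2 x)"
  have wdd: "weak_deriv 1 (\<lambda>x. \<rho> x * f1 x) dd"
  proof -
    define z where "z = (\<lambda>i::nat. if i = 0 then (\<lambda>x. \<rho> x * f1 x) else dd)"
    have "weak_deriv 1 (z 0) (z 1)"
    proof (rule weak_deriv_classical)
      fix i :: nat and x assume "i < 1"
      then show "(z i has_real_derivative z (Suc i) x) (at x)"
        by (auto simp: z_def dd_def intro!: derivative_eq_intros d\<rho> d)
    next
      fix i :: nat
      show "continuous_on UNIV (z i)"
        by (auto simp: z_def dd_def intro!: continuous_intros c\<rho> cr cf1 c)
    qed
    then show ?thesis by (simp add: z_def)
  qed
  have pde: "- (L\<^sup>2) * (\<rho> x * k\<^sup>2 * f x - dd x) =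
      L * \<mu> * (f4 x - 2 * k\<^sup>2 * f2 x + k ^ 4 * f x) - g * k\<^sup>2 * r x * f x" for x
    using eq[of x] unfolding coeff0_def coeff1_def dd_def by (simp add: algebra_simps)
  have "weak_deriv 1 f f1" "weak_deriv 2 f f2" "weak_deriv 4 f f4"
    using wd[of 1] wd[of 2] wd[of 4] unfolding wi by simp_all
  with that[OF L H4 nAE] wdd pde show ?thesis by blast
qed

end

section \<open>From the density profile to the theorem\<close>

lemma integrable_positive_derivative:
  assumes d: "\<And>x. (F has_real_derivative f x) (at x)" and c: "continuous_on UNIV f" and "\<And>x. 0 \<le> f x"
    and "(F \<longlongrightarrow> B) at_top" "(F \<longlongrightarrow> A) at_bot"
  shows "integrable lborel f"
proof -
  have "set_integrable lborel (einterval (-\<infinity>) \<infinity>) f"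
    using assms by (intro interval_integral_FTC_nonneg(1)[where F = F and A = A and B = B])
      (auto simp: continuous_on_eq_continuous_at ereal_tendsto_simps)
  then show ?thesis by (simp add: set_integrable_def)
qed

theorem theorem2p2:
  fixes g \<mu> k \<rho>\<^sub>p \<rho>\<^sub>n \<rho>\<^sub>m :: real and \<rho>\<^sub>0 :: "real \<Rightarrow> real"
  assumes "g > 0" and "\<mu> > 0" and "k > 0"
    and "\<rho>\<^sub>0 C1_differentiable_on UNIV"
    and "(\<rho>\<^sub>0 \<longlongrightarrow> \<rho>\<^sub>p) at_top" and "\<rho>\<^sub>p > 0"
    and "(\<rho>\<^sub>0 \<longlongrightarrow> \<rho>\<^sub>n) at_bot" and "\<rho>\<^sub>n > 0"
    and "\<And>x. 0 < deriv \<rho>\<^sub>0 x \<and> deriv \<rho>\<^sub>0 x < \<rho>\<^sub>m"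
  shows "\<exists>\<epsilon>\<^sub>0>0. \<forall>\<epsilon>. 0 < \<epsilon> \<and> \<epsilon> < \<epsilon>\<^sub>0 \<longrightarrow>
    (\<exists>N::nat. N \<ge> 1 \<and>
      (\<exists>\<Lambda>. finite \<Lambda> \<and> card \<Lambda> = N \<and>
        \<Lambda> \<subseteq> {lam \<in> {\<epsilon>..sqrt (g / L0 \<rho>\<^sub>0)}.
          \<exists>\<phi> \<in> sobolev_H 4. \<not> (AE x in lborel. \<phi> x = 0) \<and> solves_eq g \<mu> k \<rho>\<^sub>0 lam \<phi>}))"
proof -
  obtain D where D: "\<And>x. (\<rho>\<^sub>0 has_vector_derivative D x) (at x)" "continuous_on UNIV D"
    using assms(4) by (auto simp: C1_differentiable_on_def)
  then have dD: "(\<rho>\<^sub>0 has_real_derivative D x) (at x)" for x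
    by (simp add: has_real_derivative_iff_has_vector_derivative)
  then have "deriv \<rho>\<^sub>0 = D" by (auto intro: DERIV_imp_deriv)
  then have d: "(\<rho>\<^sub>0 has_real_derivative deriv \<rho>\<^sub>0 x) (at x)" and cd: "continuous_on UNIV (deriv \<rho>\<^sub>0)" for x
    using dD D by auto
  have mono: "\<rho>\<^sub>0 x \<le> \<rho>\<^sub>0 y" if "x \<le> y" for x y
    using assms(9) by (intro DERIV_nonneg_imp_nondecreasing[OF that]) (meson d less_imp_le)
  \<comment> \<open>Monotonicity places all values between the two limits, which provides the
    positive lower and the finite upper bound of the density.\<close>
  have lo: "\<rho>\<^sub>n \<le> \<rho>\<^sub>0 x" for x
    using assms(7) by (rule tendsto_upperbound) (auto intro!: eventually_mono[OF eventually_le_at_bot[of x]] mono)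
  have hi: "\<rho>\<^sub>0 x \<le> \<rho>\<^sub>p" for x
    using assms(5) by (rule tendsto_lowerbound) (auto intro!: eventually_mono[OF eventually_ge_at_top[of x]] mono)
  define K where "K = (SUP x. deriv \<rho>\<^sub>0 x / \<rho>\<^sub>0 x)"
  have p0: "0 < \<rho>\<^sub>0 x" for x using lo[of x] assms(8) by linarith
  \<comment> \<open>The supremum is conditionally complete, so \<open>K\<close> is an upper bound of
    the ratio only once the ratio is known to be bounded.\<close>
  have bdd: "bdd_above (range (\<lambda>x. deriv \<rho>\<^sub>0 x / \<rho>\<^sub>0 x))"
  proof (rule bdd_aboveI2)
    fix x
    show "deriv \<rho>\<^sub>0 x / \<rho>\<^sub>0 x \<le> \<rho>\<^sub>m / \<rho>\<^sub>n"
      using assms(9)[of x] lo[of x] assms(8) by (intro frac_le) auto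
  qed
  have K: "deriv \<rho>\<^sub>0 x \<le> K * \<rho>\<^sub>0 x" for x
    using cSUP_upper[OF UNIV_I bdd, of x] p0[of x] by (simp add: K_def divide_le_eq)
  \<comment> \<open>The density rises by a finite total amount, the difference of its limits, so its
    nonnegative derivative has finite integral.\<close>
  have int: "integrable lborel (deriv \<rho>\<^sub>0)"
    using assms(9) by (intro integrable_positive_derivative[OF d cd _ assms(5,7)]) (simp add: less_imp_le)
  interpret stratification g \<mu> k \<rho>\<^sub>n \<rho>\<^sub>p \<rho>\<^sub>m K \<rho>\<^sub>0 "deriv \<rho>\<^sub>0"
    by unfold_locales (use assms d cd K int lo hi in \<open>auto simp: less_imp_le\<close>)
  obtain L \<phi> where L: "L > 0" "L\<^sup>2 \<le> g * K" and \<phi>: "\<phi> \<in> sobolev_H 4" "\<not> (AE x in lborel. \<phi> x = 0)"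
    and eq: "\<exists>\<phi>1 \<phi>2 \<phi>4 d. weak_deriv 1 \<phi> \<phi>1 \<and> weak_deriv 2 \<phi> \<phi>2 \<and> weak_deriv 4 \<phi> \<phi>4 \<and>
      weak_deriv 1 (\<lambda>x. \<rho>\<^sub>0 x * \<phi>1 x) d \<and>
      (\<forall>x. - (L\<^sup>2) * (\<rho>\<^sub>0 x * k\<^sup>2 * \<phi> x - d x) =
        L * \<mu> * (\<phi>4 x - 2 * k\<^sup>2 * \<phi>2 x + k ^ 4 * \<phi> x) - g * k\<^sup>2 * deriv \<rho>\<^sub>0 x * \<phi> x)"
    using eigenvalue_exists by blast
  have sol: "solves_eq g \<mu> k \<rho>\<^sub>0 L \<phi>"
    unfolding solves_eq_def using eq by (meson AE_I2)
  have "g / L0 \<rho>\<^sub>0 = g * K" by (simp add: L0_def K_def divide_inverse)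
  then have top: "L \<le> sqrt (g / L0 \<rho>\<^sub>0)" using L(2) by (simp add: real_le_rsqrt)
  show ?thesis
  proof (intro exI[of _ L] conjI allI impI)
    fix \<epsilon> assume \<epsilon>: "0 < \<epsilon> \<and> \<epsilon> < L"
    show "\<exists>N::nat. N \<ge> 1 \<and>
      (\<exists>\<Lambda>. finite \<Lambda> \<and> card \<Lambda> = N \<and>
        \<Lambda> \<subseteq> {lam \<in> {\<epsilon>..sqrt (g / L0 \<rho>\<^sub>0)}.
          \<exists>\<phi> \<in> sobolev_H 4. \<not> (AE x in lborel. \<phi> x = 0) \<and> solves_eq g \<mu> k \<rho>\<^sub>0 lam \<phi>})"
      using \<epsilon> top \<phi> sol by (intro exI[of _ "1::nat"] exI[of _ "{L}"] conjI) auto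
  qed (rule L(1))
qed

end
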